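(* Let $k \geq 2$ and $n > 2k$. Then the arc $k$-tuple complex $A_k(D_n)$ is connected.
   Context: $D_n$ denotes the closed disk with $n$ punctures. An arc in $D_n$ is a simple arc connecting two distinct punctures (its ends); arcs are considered up to isotopy. The arc $k$-tuple complex $A_k(D_n)$ is the graph whose vertices are the (unordered) $k$-tuples of (isotopy classes of) disjoint arcs in $D_n$, with all $2k$ ends distinct, and whose edges join pairs of $k$-tuples that share a $(k-1)$-tuple, i.e. that have $k-1$ arcs in common. *)

theory Defs
  imports "Graph_Theory.Digraph_Component" "HOL-Analysis.Analysis"
begin

text \<open>
  The closed disk with \<open>n\<close> punctures is the closed unit disk of the complex plane together with a
  set \<open>P\<close> of \<open>n\<close> marked points in its interior. An arc has its two ends at punctures, so the
  punctures are kept as points of the disk, and an arc meets \<open>P\<close> exactly in its two ends.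
  (\<open>arc\<close> is the library's notion of an injective path, so the two ends are distinct.)
\<close>

definition param_arc :: "complex set \<Rightarrow> (real \<Rightarrow> complex) \<Rightarrow> bool" where
  "param_arc P g \<longleftrightarrow>
     arc g \<and> path_image g \<subseteq> cball 0 1 \<and> path_image g \<inter> P = {pathstart g, pathfinish g}"

text \<open>Arcs carry no orientation or parametrisation: they are subsets of the disk.\<close>

definition disk_arcs :: "complex set \<Rightarrow> complex set set" where
  "disk_arcs P = {path_image g | g. param_arc P g}"

text \<open>
  Two arcs are isotopic if some parametrisations of them are joined by a continuous family of
  parametrised arcs. For finite \<open>P\<close> the ends of the arcs in such a family cannot move, since they
  depend continuously on the time and stay in \<open>P\<close>.
\<close>

definition arc_isotopy :: "complex set \<Rightarrow> (complex set \<times> complex set) set" where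
  "arc_isotopy P =
     {(path_image p, path_image q) | p q.
        homotopic_with_canon (param_arc P) {0..1} (cball 0 1) p q}"

definition isotopy_class :: "complex set \<Rightarrow> complex set \<Rightarrow> complex set set" where
  "isotopy_class P a = arc_isotopy P `` {a}"

text \<open>
  Systems of \<open>k\<close> arcs in the punctured disk: the arcs are disjoint away from the punctures, and
  \<open>a \<inter> P\<close> is the set of ends of the arc \<open>a\<close>, so that the last conjunct says that all \<open>2k\<close> ends
  are distinct.
\<close>

definition arc_system :: "nat \<Rightarrow> complex set \<Rightarrow> complex set set \<Rightarrow> bool" where
  "arc_system k P S \<longleftrightarrow>
     finite S \<and> card S = k \<and> S \<subseteq> disk_arcs P \<and>
     pairwise (\<lambda>a b. disjnt (a - P) (b - P)) S \<and>
     card (\<Union>a\<in>S. a \<inter> P) = 2 * k"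

text \<open>
  A vertex is a set of \<open>k\<close> isotopy classes with simultaneously disjoint representatives. (Arcs of a
  system have different ends, so their classes are different.)
\<close>

definition arc_tuples :: "nat \<Rightarrow> complex set \<Rightarrow> complex set set set set" where
  "arc_tuples k P = {isotopy_class P ` S | S. arc_system k P S}"

text \<open>The undirected graph is represented by the digraph containing both orientations of each edge.\<close>

definition arc_tuple_complex ::
  "nat \<Rightarrow> complex set \<Rightarrow> complex set set set pair_pre_digraph" where
  "arc_tuple_complex k P =
     \<lparr> pverts = arc_tuples k P,
       parcs = {(V, W). V \<in> arc_tuples k P \<and> W \<in> arc_tuples k P \<and> card (V \<inter> W) = k - 1} \<rparr>"

end

theory Submission
  imports Defs
begin

text \<open>
  The proof works with actual arcs as far as possible, and with isotopy classes only at the very end.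
  Replacing one arc of a system by any other arc that is disjoint from the remaining ones gives the same
  vertex or an adjacent vertex, so it suffices to connect systems by such exchanges.

  This is possible because disjoint arcs in the open disk never separate it: by Janiszewski's theorem
  their union has a connected complement (\<open>connected_Compl_Un\<close>), and so any two free punctures can be
  joined by a further arc. In particular every system of fewer arcs extends to a system of \<open>k\<close> arcs,
  and by induction on the number of arcs that two systems have in common
  (\<open>exchange_connected_over\<close>) the problem is reduced to two arcs: if some disjoint arcs are removed from
  the disk and at least five punctures remain, then any two arcs \<open>A\<close> and \<open>B\<close> between these are linked by
  a chain in which consecutive arcs are disjoint (\<open>disjointness_connected\<close>). The five punctures are
  where \<open>n > 2 * k\<close> enters: with \<open>k - 2\<close> arcs removed, \<open>n - 2 * (k - 2) \<ge> 5\<close> punctures are left.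

  If \<open>A\<close> and \<open>B\<close> share an end and their intersection is connected, then their union does not separate
  and leaves two punctures free; an arc between these is disjoint from both. In general, follow \<open>A\<close> from
  an end to its first point on \<open>B\<close> and continue along \<open>B\<close> in one of the two directions. The new arc
  meets \<open>B\<close> in a connected set, and it meets \<open>A\<close> in fewer pieces than \<open>B\<close> does if the direction is
  chosen well (\<open>linked_if_finitely_many_pieces\<close>). To start this induction the number of pieces has to be
  finite. An arbitrary arc may be wild, but it is disjoint from some polygonal arc, which can serve as
  the next arc of the chain, and polygonal arcs intersect in finitely many pieces.

  Isotopies enter twice. Arcs of a vertex may run along the boundary circle, where they can separate the
  disk; a radial isotopy first pushes them into the open disk (\<open>inner_representatives\<close>). And isotopic arcs
  have the same ends (\<open>arc_isotopy_same_ends\<close>), so the \<open>k\<close> arcs of a system have \<open>k\<close> different classes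
  and exchanges are edges (\<open>exchange_imp_edge\<close>).
\<close>

\<comment> \<open>From here on \<open>connected\<close> is the topological notion.\<close>
hide_const (open) Digraph_Component.connected

section \<open>Arcs as point sets\<close>

text \<open>
  Surgery cuts and pastes arcs as point sets, so parametrisations are hidden here. The relation is
  symmetric in the two ends, so paths need not be reversed in the surgery.
\<close>

definition arc_between :: "'a::real_normed_vector \<Rightarrow> 'a \<Rightarrow> 'a set \<Rightarrow> bool" where
  "arc_between p q A \<longleftrightarrow> (\<exists>g. arc g \<and> pathstart g = p \<and> pathfinish g = q \<and> path_image g = A)"

lemma arc_between_sym: "arc_between p q A \<Longrightarrow> arc_between q p A"
  unfolding arc_between_def
  by (metis arc_reversepath path_image_reversepath pathfinish_reversepath pathstart_reversepath)

lemma arc_between_distinct: "arc_between p q A \<Longrightarrow> p \<noteq> q"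
  unfolding arc_between_def using arc_distinct_ends by blast

lemma arc_between_ends: "arc_between p q A \<Longrightarrow> p \<in> A" "arc_between p q A \<Longrightarrow> q \<in> A"
  unfolding arc_between_def by auto

lemma arc_between_compact: "arc_between p q A \<Longrightarrow> compact A"
  unfolding arc_between_def using compact_path_image arc_imp_path by blast

lemma arc_between_connected: "arc_between p q A \<Longrightarrow> connected A"
  unfolding arc_between_def using connected_path_image arc_imp_path by blast

lemma arc_between_join:
  assumes "arc_between p x A" "arc_between x q B" "A \<inter> B = {x}"
  shows "arc_between p q (A \<union> B)"
proof -
  obtain g h where "arc g" "pathstart g = p" "pathfinish g = x" "path_image g = A"
      "arc h" "pathstart h = x" "pathfinish h = q" "path_image h = B"
    using assms unfolding arc_between_def by blast
  then show ?thesis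
    unfolding arc_between_def using assms(3)
    by (intro exI[of _ "g +++ h"]) (simp add: arc_join path_image_join)
qed

lemma arc_between_subarc:
  assumes "arc g" "0 \<le> u" "u < v" "v \<le> 1"
  shows "arc_between (g u) (g v) (g ` {u..v})"
  unfolding arc_between_def using assms
  by (intro exI[of _ "subpath u v g"]) (auto simp: arc_subpath_arc path_image_subpath)

lemma arc_between_split:
  assumes "arc_between p q A" "x \<in> A" "x \<noteq> p" "x \<noteq> q"
  obtains B C where "arc_between p x B" "arc_between x q C" "B \<union> C = A" "B \<inter> C = {x}"
proof -
  obtain g where g: "arc g" "pathstart g = p" "pathfinish g = q" "path_image g = A"
    using assms(1) unfolding arc_between_def by blast
  then obtain t where t: "t \<in> {0..1}" "x = g t"
    using assms(2) unfolding path_image_def by blast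
  have t01: "t \<noteq> 0" "t \<noteq> 1"
    using assms(3,4) g t unfolding pathstart_def pathfinish_def by auto
  show thesis
  proof (rule that)
    show "arc_between p x (g ` {0..t})"
      using arc_between_subarc[of g 0 t] g t t01 by (simp add: pathstart_def)
    show "arc_between x q (g ` {t..1})"
      using arc_between_subarc[of g t 1] g t t01 by (simp add: pathfinish_def)
    have "{0..t} \<union> {t..1} = {0..1}"
      using t by auto
    then show "g ` {0..t} \<union> g ` {t..1} = A"
      using g(4) by (simp add: path_image_def flip: image_Un)
    have "g ` {0..t} \<inter> g ` {t..1} = g ` ({0..t} \<inter> {t..1})"
      using g(1) t unfolding arc_def by (intro inj_on_image_Int[symmetric, of g "{0..1}"]) auto
    also have "{0..t} \<inter> {t..1} = {t}"
      using t by auto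
    finally show "g ` {0..t} \<inter> g ` {t..1} = {x}"
      using t by simp
  qed
qed

text \<open>
  Travelling from the end \<open>p\<close>, the arc meets the closed set \<open>B\<close> a first time, because the set of
  parameters with values in \<open>B\<close> is compact. The last conclusion describes what is left of the arc after
  the hit \<open>x\<close>: nothing, or a remainder that touches the initial piece only in \<open>x\<close>.
\<close>

lemma arc_between_first_hit:
  assumes "arc_between p q A" "closed B" "p \<notin> B" "A \<inter> B \<noteq> {}"
  obtains x C where "arc_between p x C" "C \<subseteq> A" "C \<inter> B = {x}"
    "x = q \<and> C = A \<or> x \<noteq> q \<and> (\<exists>D. arc_between x q D \<and> C \<union> D = A \<and> C \<inter> D = {x})"
proof -
  obtain g where g: "arc g" "pathstart g = p" "pathfinish g = q" "path_image g = A"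
    using assms(1) unfolding arc_between_def by blast
  define T where "T = {0..1} \<inter> g -` B"
  have "continuous_on {0..1} g"
    using g(1) unfolding arc_def path_def by blast
  then have "closed T"
    unfolding T_def using assms(2) by (intro continuous_closed_preimage) auto
  moreover have "T \<subseteq> {0..1}"
    unfolding T_def by blast
  ultimately have "compact T"
    using compact_Icc closed_Int_compact[of T "{0..1}"] by (simp add: Int_absorb2)
  moreover have "T \<noteq> {}"
    using assms(4) g(4) unfolding T_def path_image_def by blast
  ultimately obtain t where t: "t \<in> T" "\<And>s. s \<in> T \<Longrightarrow> t \<le> s"
    using compact_attains_inf by metis
  have t01: "t \<in> {0..1}" "g t \<in> B" "t \<noteq> 0"
    using t g(2) assms(3) unfolding T_def pathstart_def by auto
  show thesis
  proof (rule that)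
    show "arc_between p (g t) (g ` {0..t})"
      using arc_between_subarc[of g 0 t] g t01 by (simp add: pathstart_def)
    show "g ` {0..t} \<subseteq> A"
      using g(4) t01 unfolding path_image_def by auto
    have first: "s = t" if "s \<in> {0..t}" "g s \<in> B" for s
    proof -
      have "s \<in> T"
        using that t01 unfolding T_def by auto
      then show ?thesis
        using t(2)[of s] that by auto
    qed
    have "y = g t" if y: "y \<in> g ` {0..t} \<inter> B" for y
    proof -
      obtain s where "s \<in> {0..t}" "y = g s"
        using y by blast
      then show ?thesis
        using first[of s] y by simp
    qed
    moreover have "g t \<in> g ` {0..t} \<inter> B"
      using t01 by simp
    ultimately show "g ` {0..t} \<inter> B = {g t}"
      by blast
    show "g t = q \<and> g ` {0..t} = A \<or> g t \<noteq> q \<and> 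
      (\<exists>D. arc_between (g t) q D \<and> g ` {0..t} \<union> D = A \<and> g ` {0..t} \<inter> D = {g t})"
    proof (cases "t = 1")
      case True
      then show ?thesis
        using g unfolding path_image_def pathfinish_def by auto
    next
      case False
      have "g t \<noteq> g 1"
        using g(1) t01 False unfolding arc_def inj_on_def by force
      moreover have "arc_between (g t) q (g ` {t..1})"
        using arc_between_subarc[of g t 1] g t01 False by (simp add: pathfinish_def)
      moreover have "{0..t} \<union> {t..1} = {0..1}"
        using t01 by auto
      then have "g ` {0..t} \<union> g ` {t..1} = A"
        using g(4) by (simp add: path_image_def flip: image_Un)
      moreover have "g ` {0..t} \<inter> g ` {t..1} = g ` ({0..t} \<inter> {t..1})"
        using g(1) t01 unfolding arc_def by (intro inj_on_image_Int[symmetric, of g "{0..1}"]) auto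
      moreover have "{0..t} \<inter> {t..1} = {t}"
        using t01 by auto
      ultimately show ?thesis
        using g(3) by (intro disjI2 conjI exI[of _ "g ` {t..1}"]) (simp_all add: pathfinish_def)
    qed
  qed
qed

text \<open>
  Connected subsets of an arc correspond to intervals of parameters, and intervals intersect in
  intervals.
\<close>

lemma arc_between_connected_Int:
  assumes "arc_between p q A" "connected C" "connected D" "C \<subseteq> A" "D \<subseteq> A"
  shows "connected (C \<inter> D)"
proof -
  obtain g where g: "arc g" "path_image g = A"
    using assms(1) unfolding arc_between_def by blast
  then obtain h where h: "homeomorphism {0..1} A g h"
    using homeomorphism_arc by metis
  have hA: "continuous_on A h" "inj_on h A" and gh: "\<And>x. x \<in> A \<Longrightarrow> g (h x) = x"
    using h unfolding homeomorphism_def by (auto intro: inj_on_inverseI)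
  have "connected (h ` C)" "connected (h ` D)"
    using assms(2-5) by (simp_all add: connected_continuous_image continuous_on_subset[OF hA(1)])
  then have "connected (h ` C \<inter> h ` D)"
    by (simp add: is_interval_connected_1[symmetric] is_interval_Int)
  moreover have "h ` C \<inter> h ` D = h ` (C \<inter> D)"
    using inj_on_image_Int[OF hA(2) assms(4,5)] by simp
  ultimately have "connected (h ` (C \<inter> D))"
    by simp
  moreover have "h ` (C \<inter> D) \<subseteq> {0..1}"
    using homeomorphism_image2[OF h] assms(4) by blast
  then have "continuous_on (h ` (C \<inter> D)) g"
    by (rule continuous_on_subset[OF homeomorphism_cont1[OF h]])
  ultimately have "connected (g ` h ` (C \<inter> D))"
    by (simp add: connected_continuous_image)
  moreover have "g ` h ` (C \<inter> D) = (\<lambda>x. x) ` (C \<inter> D)"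
    unfolding image_image using gh assms(4) by (intro image_cong) auto
  ultimately show ?thesis
    by simp
qed

text \<open>
  Every point between the ends cuts the arc, so a connected set that contains both ends leaves out no
  point.
\<close>

lemma arc_between_connected_subset:
  assumes "arc_between p q A" "connected C" "C \<subseteq> A" "p \<in> C" "q \<in> C"
  shows "C = A"
proof (rule ccontr)
  assume "C \<noteq> A"
  then obtain x where x: "x \<in> A" "x \<notin> C"
    using assms by blast
  then obtain B D where BD: "arc_between p x B" "arc_between x q D" "B \<union> D = A" "B \<inter> D = {x}"
    using assms arc_between_split by metis
  have "B \<inter> D \<inter> C = {}" "C \<subseteq> B \<union> D"
    using BD x assms(3) by auto
  moreover have "closed B" "closed D"
    using BD(1,2) arc_between_compact compact_imp_closed by metis+
  ultimately have "B \<inter> C = {} \<or> D \<inter> C = {}"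
    by (intro connected_closedD[OF assms(2)])
  moreover have "p \<in> B" "q \<in> D"
    using arc_between_ends(1)[OF BD(1)] arc_between_ends(2)[OF BD(2)] .
  ultimately show False
    using assms by blast
qed

section \<open>Polygonal arcs\<close>

text \<open>
  The polygonal sets of this development. Finite unions of \<^emph>\<open>connected\<close> collinear sets are used rather
  than finite unions of closed segments, because this class is obviously inherited by subarcs. What is
  gained is that two such sets meet in finitely many connected pieces, so that a surgery argument can
  count these pieces without any general position.
\<close>

definition segmental :: "'a::euclidean_space set \<Rightarrow> bool" where
  "segmental A \<longleftrightarrow> (\<exists>\<C>. finite \<C> \<and> \<Union>\<C> = A \<and> (\<forall>C\<in>\<C>. connected C \<and> collinear C))"

lemma segmental_closed_segment: "segmental (closed_segment a b)"
  unfolding segmental_def by (intro exI[of _ "{closed_segment a b}"]) simp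

lemma segmental_Un:
  assumes "segmental A" "segmental B"
  shows "segmental (A \<union> B)"
proof -
  obtain \<C> \<D> where "finite \<C>" "\<Union>\<C> = A" "\<forall>C\<in>\<C>. connected C \<and> collinear C"
      "finite \<D>" "\<Union>\<D> = B" "\<forall>C\<in>\<D>. connected C \<and> collinear C"
    using assms unfolding segmental_def by metis
  then show ?thesis
    unfolding segmental_def by (intro exI[of _ "\<C> \<union> \<D>"]) auto
qed

lemma segmental_subarc:
  assumes "segmental A" "arc_between p q A" "connected B" "B \<subseteq> A"
  shows "segmental B"
proof -
  obtain \<C> where \<C>: "finite \<C>" "\<Union>\<C> = A" "\<forall>C\<in>\<C>. connected C \<and> collinear C"
    using assms unfolding segmental_def by metis
  have "connected (C \<inter> B)" if "C \<in> \<C>" for C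
  proof (rule arc_between_connected_Int[OF assms(2)])
    show "C \<subseteq> A" "connected C"
      using that \<C>(2,3) by auto
  qed (use assms(3,4) in auto)
  moreover have "collinear (C \<inter> B)" if "C \<in> \<C>" for C
    using that \<C>(3) collinear_subset[of C "C \<inter> B"] by simp
  moreover have "(\<Union>C\<in>\<C>. C \<inter> B) = B"
    using \<C>(2) assms(4) by blast
  ultimately show ?thesis
    unfolding segmental_def using \<C>(1) by (intro exI[of _ "(\<lambda>C. C \<inter> B) ` \<C>"]) simp
qed

text \<open>
  A connected collinear set is convex, and convex sets intersect in convex, hence connected, sets.
\<close>

lemma segmental_Int:
  assumes "segmental A" "segmental B"
  obtains \<E> where "finite \<E>" "\<Union>\<E> = A \<inter> B" "\<forall>E\<in>\<E>. connected E"
proof -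
  obtain \<C> \<D> where \<C>: "finite \<C>" "\<Union>\<C> = A" "\<forall>C\<in>\<C>. connected C \<and> collinear C"
    and \<D>: "finite \<D>" "\<Union>\<D> = B" "\<forall>C\<in>\<D>. connected C \<and> collinear C"
    using assms unfolding segmental_def by metis
  have "connected (C \<inter> D)" if "C \<in> \<C>" "D \<in> \<D>" for C D
  proof -
    have "convex C" "convex D"
      using that \<C>(3) \<D>(3) by (simp_all add: convex_connected_collinear)
    then show ?thesis
      by (simp add: convex_Int convex_connected)
  qed
  then show thesis
    using \<C> \<D> by (intro that[of "(\<lambda>(C, D). C \<inter> D) ` (\<C> \<times> \<D>)"]) auto
qed

lemma arc_between_closed_segment: "a \<noteq> b \<Longrightarrow> arc_between a b (closed_segment a b)"
  unfolding arc_between_def by (intro exI[of _ "linepath a b"]) simp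

text \<open>
  An arc ending in \<open>x\<close> is prolonged to \<open>y\<close> along the segment from \<open>x\<close> to \<open>y\<close>: the arc is left at its
  first point on that segment, so the result has no self-intersection.
\<close>

lemma extend_segmental_arc:
  assumes "arc_between u x A" "segmental A" "A \<subseteq> V" "closed_segment x y \<subseteq> V" "u \<noteq> y"
  obtains B where "arc_between u y B" "segmental B" "B \<subseteq> V"
proof (cases "u \<in> closed_segment x y")
  case True
  then have "closed_segment u y \<subseteq> V"
    using assms(4) subset_closed_segment[of u y x y] by auto
  then show thesis
    using that arc_between_closed_segment assms(5) segmental_closed_segment by metis
next
  case False
  have "A \<inter> closed_segment x y \<noteq> {}"
    using arc_between_ends(2)[OF assms(1)] by auto
  then obtain z C where C: "arc_between u z C" "C \<subseteq> A" "C \<inter> closed_segment x y = {z}"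
    using arc_between_first_hit[OF assms(1) closed_segment False] by metis
  have "segmental C"
    using segmental_subarc assms(1,2) C(2) arc_between_connected[OF C(1)] by metis
  show thesis
  proof (cases "z = y")
    case True
    then show ?thesis
      using that C assms(3) \<open>segmental C\<close> by blast
  next
    case False
    have "z \<in> closed_segment x y"
      using C(3) by blast
    then have sub: "closed_segment z y \<subseteq> closed_segment x y"
      by (simp add: subset_closed_segment)
    have "z \<in> C"
      using C(3) by blast
    then have "C \<inter> closed_segment z y = {z}"
      using C(3) sub by auto
    then have "arc_between u y (C \<union> closed_segment z y)"
      using arc_between_join[OF C(1) arc_between_closed_segment[OF False]] by simp
    moreover have "segmental (C \<union> closed_segment z y)"
      using segmental_Un[OF \<open>segmental C\<close> segmental_closed_segment] .
    moreover have "C \<union> closed_segment z y \<subseteq> V"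
      using C(2) sub assms(3,4) by blast
    ultimately show ?thesis
      using that by simp
  qed
qed

text \<open>
  The points that can be reached from \<open>u\<close> form an open and closed subset of \<open>V\<close>, because inside a
  ball a reachable point can be joined to any other point by a segment.
\<close>

lemma segmental_arc_exists:
  fixes V :: "'a::euclidean_space set"
  assumes "open V" "connected V" "u \<in> V" "v \<in> V" "u \<noteq> v"
  obtains A where "arc_between u v A" "segmental A" "A \<subseteq> V"
proof -
  define P where "P w \<longleftrightarrow> w = u \<or> (\<exists>A. arc_between u w A \<and> segmental A \<and> A \<subseteq> V)" for w
  have "\<exists>T. openin (top_of_set V) T \<and> a \<in> T \<and> (\<forall>x\<in>T. \<forall>y\<in>T. P x \<longrightarrow> P y)" if "a \<in> V" for a
  proof -
    obtain e where e: "e > 0" "ball a e \<subseteq> V"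
      using assms(1) \<open>a \<in> V\<close> openE by metis
    have "P y" if xy: "x \<in> ball a e" "y \<in> ball a e" "P x" for x y
    proof -
      have sub: "closed_segment x y \<subseteq> V"
        using xy(1,2) e(2) closed_segment_subset[OF _ _ convex_ball] by blast
      have "P y" if "y \<noteq> u"
      proof (cases "x = u")
        case True
        then show ?thesis
          using arc_between_closed_segment[of u y] segmental_closed_segment[of u y] sub True \<open>y \<noteq> u\<close>
          unfolding P_def by metis
      next
        case False
        then obtain A where "arc_between u x A" "segmental A" "A \<subseteq> V"
          using xy(3) unfolding P_def by metis
        then obtain B where "arc_between u y B" "segmental B" "B \<subseteq> V"
          using extend_segmental_arc[of u x A V y] sub \<open>y \<noteq> u\<close> by metis
        then show ?thesis
          unfolding P_def by metis
      qed
      then show ?thesis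
        unfolding P_def by metis
    qed
    then have "\<forall>x\<in>ball a e. \<forall>y\<in>ball a e. P x \<longrightarrow> P y"
      by blast
    moreover have "openin (top_of_set V) (ball a e)"
      using e(2) assms(1) by (simp add: openin_open_eq)
    moreover have "a \<in> ball a e"
      using e(1) by simp
    ultimately show ?thesis
      by blast
  qed
  moreover have "P u"
    unfolding P_def by simp
  ultimately have "P v"
    using connected_induction_simple[of V u v P] assms(2-4) by blast
  then show thesis
    using that assms(5) unfolding P_def by blast
qed

section \<open>The disjointness graph of arcs in a planar region\<close>

text \<open>
  Janiszewski's theorem for sets that do not separate the plane at all. Disjoint sets also satisfy its
  hypothesis, the empty set being connected. Together with the fact that a single arc does not separate
  the plane, this is what provides room for new arcs below.
\<close>

lemma connected_Compl_Un:
  fixes S T :: "complex set"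
  assumes "compact S" "closed T" "connected (S \<inter> T)" "connected (- S)" "connected (- T)"
  shows "connected (- (S \<union> T))"
  unfolding connected_iff_connected_component
proof (intro ballI)
  fix a b assume "a \<in> - (S \<union> T)" "b \<in> - (S \<union> T)"
  then have "connected_component (- S) a b" "connected_component (- T) a b"
    using assms(4,5) by (simp_all add: connected_iff_connected_component)
  then show "connected_component (- (S \<union> T)) a b"
    using Janiszewski assms(1-3) by blast
qed

lemma arc_between_connected_Compl:
  fixes A :: "complex set"
  shows "arc_between p q A \<Longrightarrow> connected (- A)"
  unfolding arc_between_def by (metis connected_arc_complement DIM_complex order_refl)

text \<open>
  Here \<open>K\<close> is an obstacle that arcs must avoid, and \<open>Q\<close> is the set of punctures. The disk itself is the
  case where \<open>K\<close> is the outside of the open disk; arcs that have been fixed are added to \<open>K\<close>.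
\<close>

definition puncture_arc :: "complex set \<Rightarrow> complex set \<Rightarrow> complex set \<Rightarrow> bool" where
  "puncture_arc K Q A \<longleftrightarrow> (\<exists>p q. arc_between p q A \<and> A \<inter> Q = {p, q}) \<and> A \<inter> K = {}"

lemma puncture_arc_compact: "puncture_arc K Q A \<Longrightarrow> compact A"
  unfolding puncture_arc_def using arc_between_compact by blast

lemma puncture_arc_connected_Compl: "puncture_arc K Q A \<Longrightarrow> connected (- A)"
  unfolding puncture_arc_def using arc_between_connected_Compl by blast

lemma puncture_arc_card_ends: "puncture_arc K Q A \<Longrightarrow> card (A \<inter> Q) = 2"
  unfolding puncture_arc_def using arc_between_distinct by (metis card_2_iff)

lemma puncture_arc_off: "puncture_arc K Q A \<Longrightarrow> A \<inter> K = {}"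
  unfolding puncture_arc_def by simp

locale planar_region =
  fixes K Q :: "complex set"
  assumes closed_K: "closed K" and connected_Compl_K: "connected (- K)"
    and finite_Q: "finite Q" and Q_off_K: "Q \<inter> K = {}"
begin

text \<open>
  The complement of \<open>S \<union> K\<close> is open and connected, and remains so when the punctures other than two
  chosen ones are removed.
\<close>

lemma exists_arc_avoiding:
  assumes "compact S" "S \<inter> K = {}" "connected (- S)" "card (Q - S) \<ge> 2"
  obtains A where "puncture_arc K Q A" "segmental A" "A \<inter> S = {}"
proof -
  obtain T where "T \<subseteq> Q - S" "card T = 2"
    using obtain_subset_with_card_n[OF assms(4)] by metis
  then obtain u v where uv: "u \<in> Q - S" "v \<in> Q - S" "u \<noteq> v"
    by (auto simp: card_2_iff)
  define V where "V = - (S \<union> K) - (Q - {u, v})"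
  have "open (- (S \<union> K))"
    using assms(1) closed_K compact_imp_closed by (intro open_Compl closed_Un) auto
  moreover have "connected (- (S \<union> K))"
    using assms(1-3) closed_K connected_Compl_K by (intro connected_Compl_Un) auto
  ultimately have "open V" "connected V"
    unfolding V_def using finite_Q
    by (auto intro!: open_Diff finite_imp_closed connected_open_delete_finite)
  moreover have "u \<in> V" "v \<in> V"
    using uv Q_off_K unfolding V_def by auto
  ultimately obtain A where A: "arc_between u v A" "segmental A" "A \<subseteq> V"
    using segmental_arc_exists uv(3) by metis
  have "A \<inter> Q = {u, v}"
    using A(3) arc_between_ends[OF A(1)] uv unfolding V_def by auto
  moreover have "A \<inter> K = {}" "A \<inter> S = {}"
    using A(3) unfolding V_def by auto
  ultimately show thesis
    using that A(1,2) unfolding puncture_arc_def by blast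
qed

definition disjointness :: "(complex set \<times> complex set) set" where
  "disjointness = {(A, B). puncture_arc K Q A \<and> puncture_arc K Q B \<and> A \<inter> B = {}}"

text \<open>
  The union of the two arcs does not separate the plane and contains at most three punctures, so the
  two or more remaining ones are joined by an arc that is disjoint from both.
\<close>

lemma linked_if_common_end:
  assumes Q5: "card Q \<ge> 5" and "puncture_arc K Q A" "puncture_arc K Q B"
    and "connected (A \<inter> B)" and common: "A \<inter> B \<inter> Q \<noteq> {}"
  shows "(A, B) \<in> disjointness\<^sup>*"
proof -
  have "connected (- (A \<union> B))"
    using assms puncture_arc_compact puncture_arc_connected_Compl
    by (intro connected_Compl_Un) (auto intro: compact_imp_closed)
  moreover have "compact (A \<union> B)"
    using assms(2,3) puncture_arc_compact by (intro compact_Un) auto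
  moreover have "(A \<union> B) \<inter> K = {}"
    using assms(2,3) puncture_arc_off by (simp add: Int_Un_distrib2)
  moreover have "card (Q - (A \<union> B)) \<ge> 2"
  proof -
    have fin: "finite (A \<inter> Q)" "finite (B \<inter> Q)"
      using finite_Q by auto
    have "card ((A \<inter> Q) \<inter> (B \<inter> Q)) > 0"
      using common fin by (simp add: card_gt_0_iff) auto
    then have "card ((A \<inter> Q) \<union> (B \<inter> Q)) \<le> 3"
      using card_Un_Int[OF fin] puncture_arc_card_ends assms(2,3) by simp
    moreover have "Q - (A \<union> B) = Q - ((A \<inter> Q) \<union> (B \<inter> Q))"
      by blast
    moreover have "card Q - card ((A \<inter> Q) \<union> (B \<inter> Q)) \<le> card (Q - ((A \<inter> Q) \<union> (B \<inter> Q)))"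
      using fin by (intro diff_card_le_card_Diff) auto
    ultimately show ?thesis
      using Q5 by simp
  qed
  ultimately obtain C where "puncture_arc K Q C" "C \<inter> (A \<union> B) = {}"
    using exists_arc_avoiding by metis
  then have "(A, C) \<in> disjointness" "(C, B) \<in> disjointness"
    using assms(2,3) unfolding disjointness_def by auto
  then show ?thesis
    by (meson r_into_rtrancl rtrancl_trans)
qed

text \<open>
  The arc \<open>A\<close> is followed from its end \<open>p\<close> to its first point \<open>x\<close> on \<open>B\<close>, and then \<open>B\<close> is followed along
  \<open>D\<close> to its end \<open>r\<close>. The resulting arc meets \<open>B\<close> in the connected set \<open>D\<close>. It meets \<open>A\<close> in the
  initial piece \<open>A1\<close> and in that part of the intersection of \<open>A\<close> and \<open>B\<close> that lies on \<open>D\<close>.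
\<close>

lemma surgery:
  assumes "A \<inter> Q = {p, q}" "A \<inter> K = {}" "B \<inter> Q = {r, s}" "B \<inter> K = {}"
    and "arc_between p x A1" "A1 \<subseteq> A" "A1 \<inter> B = {x}" "q \<notin> A1"
    and "arc_between x r D" "D \<subseteq> B" "s \<notin> D"
  shows "puncture_arc K Q (A1 \<union> D)" "(A1 \<union> D) \<inter> Q = {p, r}"
    "(A1 \<union> D) \<inter> B = D" "A \<inter> (A1 \<union> D) = A1 \<union> (A \<inter> B \<inter> D)"
proof -
  have xD: "x \<in> D" "r \<in> D" and pA: "p \<in> A1"
    using arc_between_ends assms(5,9) by metis+
  have xA1: "x \<in> A1" and A1B: "\<And>y. y \<in> A1 \<Longrightarrow> y \<in> B \<Longrightarrow> y = x"
    using assms(7) by auto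
  have "A1 \<inter> D = {x}"
    using assms(10) xD xA1 A1B by auto
  then have arc: "arc_between p r (A1 \<union> D)"
    using arc_between_join assms(5,9) by metis
  have "A1 \<inter> Q = {p}" "D \<inter> Q = {r}"
    using assms(1,3,6,8,10,11) xD pA by auto
  then show Q: "(A1 \<union> D) \<inter> Q = {p, r}"
    by (simp add: Int_Un_distrib2) auto
  have "(A1 \<union> D) \<inter> K = {}"
    using assms(2,4,6,10) by auto
  then show "puncture_arc K Q (A1 \<union> D)"
    unfolding puncture_arc_def using arc Q by blast
  show "(A1 \<union> D) \<inter> B = D"
    using assms(10) xD A1B by auto
  show "A \<inter> (A1 \<union> D) = A1 \<union> (A \<inter> B \<inter> D)"
    using assms(6,10) by blast
qed

text \<open>
  Induction on the number of connected pieces that cover the intersection. Since the ends differ, some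
  end \<open>p\<close> of \<open>A\<close> is not on \<open>B\<close>, and surgery from \<open>p\<close> yields an arc \<open>C\<close> along either half of \<open>B\<close>. Each
  choice shares an end with \<open>B\<close> and meets it in a connected set, so \<open>C\<close> is always linked to \<open>B\<close>. If the
  intersection of \<open>A\<close> and \<open>B\<close> is connected, then \<open>C\<close> is linked to \<open>A\<close> for the same reason. Otherwise
  some piece \<open>E\<close> misses the first hit \<open>x\<close>; it lies on one half of \<open>B\<close>, and taking the other half loses
  \<open>E\<close>, while all pieces through \<open>x\<close> merge with the initial part of \<open>A\<close> into a single one.

  The induction needs \<open>C\<close> and \<open>A\<close> to have different ends. This can only fail if the second end \<open>q\<close> of
  \<open>A\<close> is an end of \<open>B\<close> as well, and then \<open>E\<close> is chosen to contain \<open>q\<close>, so that \<open>C\<close> does not reach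
  \<open>q\<close>.
\<close>

lemma linked_if_finitely_many_pieces:
  assumes Q5: "card Q \<ge> 5"
  shows "puncture_arc K Q A \<Longrightarrow> puncture_arc K Q B \<Longrightarrow> A \<inter> Q \<noteq> B \<inter> Q \<Longrightarrow>
    finite \<C> \<Longrightarrow> \<forall>C\<in>\<C>. connected C \<Longrightarrow> \<Union>\<C> = A \<inter> B \<Longrightarrow> (A, B) \<in> disjointness\<^sup>*"
proof (induction "card \<C>" arbitrary: A B \<C> rule: less_induct)
  case less
  note A = less.prems(1) and B = less.prems(2) and ends = less.prems(3)
  have \<C>: "finite \<C>" "\<And>F. F \<in> \<C> \<Longrightarrow> connected F" "\<Union>\<C> = A \<inter> B"
    using less.prems(4-6) by auto
  have "\<not> A \<inter> Q \<subseteq> B \<inter> Q"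
    using ends card_subset_eq[of "B \<inter> Q" "A \<inter> Q"] finite_Q puncture_arc_card_ends A B by auto
  then obtain p where p: "p \<in> A" "p \<in> Q" "p \<notin> B"
    by blast
  obtain a b where ab: "arc_between a b A" "A \<inter> Q = {a, b}" and AK: "A \<inter> K = {}"
    using A unfolding puncture_arc_def by metis
  then have "p = a \<or> p = b"
    using p by blast
  then obtain q where q: "arc_between p q A" "A \<inter> Q = {p, q}"
    using ab arc_between_sym by (metis insert_commute)
  obtain r s where rs: "arc_between r s B" "B \<inter> Q = {r, s}" and BK: "B \<inter> K = {}"
    using B unfolding puncture_arc_def by metis
  have qA: "q \<in> A" "q \<in> Q"
    using q(2) by auto
  show ?case
  proof (cases "A \<inter> B = {} \<or> A \<inter> B = {q}")
    case True
    then show ?thesis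
      using linked_if_common_end[OF Q5 A B] A B qA unfolding disjointness_def by auto
  next
    case False
    then obtain x A1 where A1: "arc_between p x A1" "A1 \<subseteq> A" "A1 \<inter> B = {x}" and
      alt: "x = q \<and> A1 = A \<or> x \<noteq> q \<and> (\<exists>A2. arc_between x q A2 \<and> A1 \<union> A2 = A \<and> A1 \<inter> A2 = {x})"
      using arc_between_first_hit[OF q(1) _ p(3)] puncture_arc_compact[OF B] compact_imp_closed
      by metis
    then obtain A2 where A2: "arc_between x q A2" "A1 \<union> A2 = A" "A1 \<inter> A2 = {x}" and xq: "x \<noteq> q"
      using False by blast
    have x: "x \<in> A" "x \<in> B" "x \<in> A1"
      using A1(2,3) by auto
    have qA1: "q \<notin> A1"
      using A2(3) xq arc_between_ends(2)[OF A2(1)] by auto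
    have "x \<noteq> p"
      using p(3) x(2) by blast
    then have xQ: "x \<notin> Q"
      using q(2) x(1) xq by auto
    then have "x \<noteq> r" "x \<noteq> s"
      using rs(2) by auto
    then obtain Br Bs where Br: "arc_between r x Br" and Bs: "arc_between x s Bs"
      and BB: "Br \<union> Bs = B" "Br \<inter> Bs = {x}"
      using arc_between_split[OF rs(1) x(2)] by metis
    have side: "(A, B) \<in> disjointness\<^sup>*"
      if D: "arc_between x r' D" "arc_between x s' D'" "D \<union> D' = B" "D \<inter> D' = {x}"
        and rs': "B \<inter> Q = {r', s'}"
        and good: "connected (A \<inter> B) \<or> (\<exists>E\<in>\<C>. E \<noteq> {} \<and> E \<inter> D = {} \<and> (q \<in> B \<longrightarrow> q \<in> E))"
      for r' s' D D'
    proof -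
      have s'D: "s' \<notin> D"
        using D(4) arc_between_ends(2)[OF D(2)] rs' xQ by auto
      have xD: "x \<in> D" "r' \<in> D" "D \<subseteq> B"
        using arc_between_ends[OF D(1)] D(3) by auto
      note C = surgery[OF q(2) AK rs' BK A1 qA1 D(1) xD(3) s'D]
      have "(A1 \<union> D, B) \<in> disjointness\<^sup>*"
      proof (rule linked_if_common_end[OF Q5 C(1) B])
        show "connected ((A1 \<union> D) \<inter> B)"
          using C(3) arc_between_connected[OF D(1)] by simp
        show "(A1 \<union> D) \<inter> B \<inter> Q \<noteq> {}"
          using C(3) xD(2) rs' by auto
      qed
      moreover have "(A, A1 \<union> D) \<in> disjointness\<^sup>*"
      proof (cases "connected (A \<inter> B)")
        case True
        have "connected (A \<inter> B \<inter> D)"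
          using arc_between_connected_Int[OF rs(1) True] arc_between_connected[OF D(1)] xD(3)
          by blast
        then have "connected (A \<inter> (A1 \<union> D))"
          unfolding C(4) using arc_between_connected[OF A1(1)] x xD(1)
          by (intro connected_Un) auto
        moreover have "p \<in> A \<inter> (A1 \<union> D) \<inter> Q"
          using p arc_between_ends(1)[OF A1(1)] by simp
        ultimately show ?thesis
          using linked_if_common_end[OF Q5 A C(1)] by blast
      next
        case False
        then obtain E where E: "E \<in> \<C>" "E \<noteq> {}" "E \<inter> D = {}" "q \<in> B \<Longrightarrow> q \<in> E"
          using good by blast
        obtain X where X: "X \<in> \<C>" "x \<in> X"
          using x \<C>(3) by blast
        \<comment> \<open>the piece of \<open>A \<inter> (A1 \<union> D)\<close> that contains \<open>x\<close>, and then the pieces that survive unchanged\<close>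
        define E0 where "E0 = \<Union>(insert A1 ((\<lambda>F. F \<inter> D) ` {F \<in> \<C>. x \<in> F}))"
        define \<D> where "\<D> = {F \<in> \<C>. x \<notin> F \<and> F \<subseteq> D}"
        have FB: "F \<subseteq> B" if "F \<in> \<C>" for F
          using \<C>(3) that by blast
        have "connected E0"
          unfolding E0_def
        proof (rule connected_Union)
          show "\<Inter>(insert A1 ((\<lambda>F. F \<inter> D) ` {F \<in> \<C>. x \<in> F})) \<noteq> {}"
            using x(3) xD(1) by blast
          fix S assume "S \<in> insert A1 ((\<lambda>F. F \<inter> D) ` {F \<in> \<C>. x \<in> F})"
          then consider "S = A1" | F where "F \<in> \<C>" "S = F \<inter> D"
            by blast
          then show "connected S"
          proof cases
            case 1
            then show ?thesis
              using arc_between_connected[OF A1(1)] by simp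
          next
            case (2 F)
            then show ?thesis
              using arc_between_connected_Int[OF rs(1) \<C>(2) arc_between_connected[OF D(1)] FB xD(3)]
              by simp
          qed
        qed
        moreover have pieces: "F \<subseteq> D \<or> F \<inter> D = {}" if F: "F \<in> \<C>" "x \<notin> F" for F
        proof -
          have "closed D" "closed D'"
            using arc_between_compact D(1,2) compact_imp_closed by metis+
          moreover have "F \<subseteq> D \<union> D'" "D \<inter> D' \<inter> F = {}"
            using D(3,4) FB[OF F(1)] F(2) by auto
          ultimately have "D \<inter> F = {} \<or> D' \<inter> F = {}"
            using connected_closedD[OF \<C>(2)[OF F(1)], of D D'] by blast
          then show ?thesis
            using \<open>F \<subseteq> D \<union> D'\<close> by blast
        qed
        have "\<Union>(insert E0 \<D>) = A1 \<union> (\<Union>\<C> \<inter> D)"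
        proof
          show "\<Union>(insert E0 \<D>) \<subseteq> A1 \<union> (\<Union>\<C> \<inter> D)"
            unfolding E0_def \<D>_def by auto
          show "A1 \<union> (\<Union>\<C> \<inter> D) \<subseteq> \<Union>(insert E0 \<D>)"
          proof
            fix y assume "y \<in> A1 \<union> (\<Union>\<C> \<inter> D)"
            then consider "y \<in> A1" | F where "F \<in> \<C>" "y \<in> F" "y \<in> D"
              by auto
            then show "y \<in> \<Union>(insert E0 \<D>)"
            proof cases
              case 1
              then show ?thesis
                unfolding E0_def by simp
            next
              case (2 F)
              then show ?thesis
                using pieces[of F] unfolding E0_def \<D>_def by (cases "x \<in> F") auto
            qed
          qed
        qed
        then have "\<Union>(insert E0 \<D>) = A \<inter> (A1 \<union> D)"
          unfolding C(4) \<C>(3) .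
        moreover have "card (insert E0 \<D>) < card \<C>"
        proof -
          have "X \<noteq> E" "\<D> \<subseteq> \<C> - {X, E}"
            using X(2) E(2,3) xD(1) unfolding \<D>_def by auto
          then have "card \<D> \<le> card (\<C> - {X, E})"
            using \<C>(1) by (intro card_mono) auto
          also have "\<dots> = card \<C> - 2"
            using \<C>(1) X(1) E(1) \<open>X \<noteq> E\<close> by (simp add: card_Diff_subset)
          finally have "card \<D> \<le> card \<C> - 2" .
          moreover have "card {X, E} \<le> card \<C>"
            using \<C>(1) X(1) E(1) by (intro card_mono) auto
          moreover have "card (insert E0 \<D>) \<le> Suc (card \<D>)"
            by (rule card_insert_le_m1) auto
          ultimately show ?thesis
            using \<open>X \<noteq> E\<close> by simp
        qed
        moreover have "finite (insert E0 \<D>)"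
          unfolding \<D>_def using \<C>(1) by simp
        moreover have "\<forall>F\<in>insert E0 \<D>. connected F"
          using \<open>connected E0\<close> \<C>(2) unfolding \<D>_def by auto
        moreover have "A \<inter> Q \<noteq> (A1 \<union> D) \<inter> Q"
        proof -
          have "q \<noteq> r'"
            using E(3,4) xD(2,3) by auto
          then show ?thesis
            unfolding q(2) C(2) using arc_between_distinct[OF q(1)] by auto
        qed
        ultimately show ?thesis
          using less.hyps[OF _ A C(1)] by blast
      qed
      ultimately show ?thesis
        by (meson rtrancl_trans)
    qed
    show ?thesis
    proof (cases "connected (A \<inter> B)")
      case True
      then show ?thesis
        using side[OF arc_between_sym[OF Br] Bs BB rs(2)] by blast
    next
      case False
      have "\<exists>E\<in>\<C>. E \<noteq> {} \<and> x \<notin> E \<and> (q \<in> B \<longrightarrow> q \<in> E)"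
      proof (cases "q \<in> B")
        case True
        then obtain E where E: "E \<in> \<C>" "q \<in> E"
          using qA(1) \<C>(3) by blast
        have "x \<notin> E"
        proof
          \<comment> \<open>a piece through \<open>x\<close> and \<open>q\<close> would be the whole intersection, which is not connected\<close>
          assume "x \<in> E"
          have "E \<subseteq> A" "A2 \<subseteq> A"
            using \<C>(3) E(1) A2(2) by auto
          then have "connected (E \<inter> A2)"
            using arc_between_connected_Int[OF q(1) \<C>(2)[OF E(1)] arc_between_connected[OF A2(1)]]
            by simp
          then have "E \<inter> A2 = A2"
            using arc_between_connected_subset[OF A2(1)] \<open>x \<in> E\<close> E(2) arc_between_ends[OF A2(1)]
            by simp
          moreover have "A \<inter> B \<subseteq> A2"
            using A1(3) A2(2) arc_between_ends(1)[OF A2(1)] by auto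
          ultimately have "A \<inter> B = E"
            using \<C>(3) E(1) by blast
          then show False
            using False \<C>(2)[OF E(1)] by simp
        qed
        then show ?thesis
          using E by blast
      next
        case False
        have "\<exists>E\<in>\<C>. E \<noteq> {} \<and> x \<notin> E"
        proof (rule ccontr)
          assume "\<not> ?thesis"
          then have "connected (\<Union>{F \<in> \<C>. F \<noteq> {}})"
            using \<C>(2) by (intro connected_Union) auto
          moreover have "\<Union>{F \<in> \<C>. F \<noteq> {}} = A \<inter> B"
            using \<C>(3) by blast
          ultimately show False
            using \<open>\<not> connected (A \<inter> B)\<close> by simp
        qed
        then show ?thesis
          using False by blast
      qed
      then obtain E where E: "E \<in> \<C>" "E \<noteq> {}" "x \<notin> E" "q \<in> B \<longrightarrow> q \<in> E"
        by blast
      have "closed Br" "closed Bs"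
        using arc_between_compact Br Bs compact_imp_closed by metis+
      moreover have "E \<subseteq> Br \<union> Bs" "Br \<inter> Bs \<inter> E = {}"
        using BB E(1,3) \<C>(3) by auto
      ultimately have "Br \<inter> E = {} \<or> Bs \<inter> E = {}"
        using connected_closedD[OF \<C>(2)[OF E(1)], of Br Bs] by blast
      then consider "E \<inter> Br = {}" | "E \<inter> Bs = {}"
        by blast
      then show ?thesis
      proof cases
        case 1
        then show ?thesis
          using side[OF arc_between_sym[OF Br] Bs BB rs(2)] E by blast
      next
        case 2
        have "Bs \<union> Br = B" "Bs \<inter> Br = {x}" "B \<inter> Q = {s, r}"
          using BB rs(2) by auto
        then show ?thesis
          using side[OF Bs arc_between_sym[OF Br]] E 2 by blast
      qed
    qed
  qed
qed

text \<open>
  Every arc is disjoint from some segmental arc, and segmental arcs with different ends are linked by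
  the surgery induction. Two segmental arcs with the same ends are handled by a detour through a
  segmental arc that is disjoint from one of them.
\<close>

theorem disjointness_connected:
  assumes Q5: "card Q \<ge> 5" and A: "puncture_arc K Q A" and B: "puncture_arc K Q B"
  shows "(A, B) \<in> disjointness\<^sup>*"
proof -
  have segmental_neighbour:
    "\<exists>D. puncture_arc K Q D \<and> segmental D \<and> (C, D) \<in> disjointness \<and> D \<inter> Q \<noteq> C \<inter> Q"
    if C: "puncture_arc K Q C" for C
  proof -
    have "card Q - card (C \<inter> Q) \<le> card (Q - C \<inter> Q)"
      using finite_Q by (intro diff_card_le_card_Diff) auto
    then have "card (Q - C) \<ge> 2"
      using Q5 puncture_arc_card_ends[OF C] by (simp add: Diff_Int)
    moreover have "C \<inter> K = {}"
      using C puncture_arc_off by simp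
    ultimately obtain D where D: "puncture_arc K Q D" "segmental D" "D \<inter> C = {}"
      using exists_arc_avoiding puncture_arc_compact[OF C] puncture_arc_connected_Compl[OF C]
      by metis
    moreover have "D \<inter> Q \<noteq> {}"
      using puncture_arc_card_ends[OF D(1)] by auto
    ultimately show ?thesis
      using C unfolding disjointness_def by blast
  qed
  have segmental_linked: "(C, D) \<in> disjointness\<^sup>*"
    if CD: "puncture_arc K Q C" "puncture_arc K Q D" "segmental C" "segmental D" "C \<inter> Q \<noteq> D \<inter> Q"
    for C D
  proof -
    obtain \<E> where "finite \<E>" "\<Union>\<E> = C \<inter> D" "\<forall>E\<in>\<E>. connected E"
      using segmental_Int[OF CD(3,4)] .
    then show ?thesis
      using linked_if_finitely_many_pieces[OF Q5 CD(1,2,5)] by blast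
  qed
  obtain C where C: "puncture_arc K Q C" "segmental C" "(A, C) \<in> disjointness"
    using segmental_neighbour[OF A] by blast
  obtain D where D: "puncture_arc K Q D" "segmental D" "(B, D) \<in> disjointness"
    using segmental_neighbour[OF B] by blast
  have "(C, D) \<in> disjointness\<^sup>*"
  proof (cases "C \<inter> Q = D \<inter> Q")
    case False
    then show ?thesis
      using segmental_linked C D by blast
  next
    case True
    obtain E where E: "puncture_arc K Q E" "segmental E" "(C, E) \<in> disjointness" "E \<inter> Q \<noteq> C \<inter> Q"
      using segmental_neighbour[OF C(1)] by blast
    then have "(E, D) \<in> disjointness\<^sup>*"
      using segmental_linked[OF E(1) D(1)] D(2) True by simp
    then show ?thesis
      using E(3) by (rule converse_rtrancl_into_rtrancl[rotated])
  qed
  then have "(A, D) \<in> disjointness\<^sup>*"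
    using C(3) by (rule converse_rtrancl_into_rtrancl[rotated])
  moreover have "(D, B) \<in> disjointness"
    using D(3) unfolding disjointness_def by auto
  ultimately show ?thesis
    by (rule rtrancl_into_rtrancl)
qed

end

section \<open>Exchanging the arcs of a system\<close>

text \<open>
  Arcs that reach the boundary circle may separate the closed disk, which would make exchanges of arcs
  impossible. The obstacle \<open>- ball 0 1\<close> excludes them.
\<close>

definition inner_system :: "complex set \<Rightarrow> complex set set \<Rightarrow> bool" where
  "inner_system P S \<longleftrightarrow>
     finite S \<and> (\<forall>A\<in>S. puncture_arc (- ball 0 1) P A) \<and> pairwise disjnt S"

definition exchange :: "nat \<Rightarrow> complex set \<Rightarrow> (complex set set \<times> complex set set) set" where
  "exchange k P = {(S, T). inner_system P S \<and> inner_system P T \<and>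
     card S = k \<and> card T = k \<and> card (S \<inter> T) = k - 1}"

lemma inner_system_subset: "inner_system P S \<Longrightarrow> F \<subseteq> S \<Longrightarrow> inner_system P F"
  unfolding inner_system_def using finite_subset pairwise_subset by (metis subsetD)

lemma inner_system_compact_Union: "inner_system P F \<Longrightarrow> compact (\<Union>F)"
  unfolding inner_system_def using puncture_arc_compact by (intro compact_Union) auto

lemma inner_system_connected_Compl:
  assumes "inner_system P F"
  shows "connected (- (- ball 0 1 \<union> \<Union>F))"
proof -
  have "finite F"
    using assms unfolding inner_system_def by simp
  then show ?thesis
    using assms
  proof (induction F)
    case empty
    then show ?case
      by simp
  next
    case (insert A F)
    have F: "inner_system P F"
      using insert.prems inner_system_subset by (metis subset_insertI)
    have A: "puncture_arc (- ball 0 1) P A" and disj: "\<And>B. B \<in> F \<Longrightarrow> A \<inter> B = {}"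
      using insert.prems insert.hyps(2) unfolding inner_system_def pairwise_insert disjnt_def
      by auto
    have "A \<inter> (- ball 0 1 \<union> \<Union>F) = {}"
      using puncture_arc_off[OF A] disj by auto
    moreover have "closed (- ball 0 1 \<union> \<Union>F)"
      using compact_imp_closed[OF inner_system_compact_Union[OF F]] by auto
    ultimately have "connected (- (A \<union> (- ball 0 1 \<union> \<Union>F)))"
      using connected_Compl_Un[OF puncture_arc_compact[OF A] _ _
          puncture_arc_connected_Compl[OF A] insert.IH[OF F]] by simp
    moreover have "A \<union> (- ball 0 1 \<union> \<Union>F) = - ball 0 1 \<union> \<Union>(insert A F)"
      by auto
    ultimately show ?case
      by simp
  qed
qed

lemma inner_system_planar_region:
  assumes "inner_system P F" "finite P" "P \<subseteq> ball 0 1"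
  shows "planar_region (- ball 0 1 \<union> \<Union>F) (P - \<Union>F)"
proof
  show "closed (- ball 0 1 \<union> \<Union>F)"
    using compact_imp_closed[OF inner_system_compact_Union[OF assms(1)]] by auto
  show "connected (- (- ball 0 1 \<union> \<Union>F))"
    using inner_system_connected_Compl[OF assms(1)] .
qed (use assms in auto)

lemma inner_system_card_free:
  assumes "inner_system P F" "finite P"
  shows "card (P - \<Union>F) = card P - 2 * card F"
proof -
  have "card (\<Union>A\<in>F. A \<inter> P) = (\<Sum>A\<in>F. card (A \<inter> P))"
    using assms unfolding inner_system_def pairwise_def disjnt_def
    by (intro card_UN_disjoint) auto
  also have "\<dots> = (\<Sum>A\<in>F. 2)"
    using assms(1) puncture_arc_card_ends unfolding inner_system_def by (intro sum.cong) auto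
  also have "\<dots> = 2 * card F"
    by simp
  also have "(\<Union>A\<in>F. A \<inter> P) = P \<inter> \<Union>F"
    by auto
  finally have "card (P \<inter> \<Union>F) = 2 * card F" .
  then show ?thesis
    using card_Diff_subset_Int[of P "\<Union>F"] assms(2) by simp
qed

lemma inner_system_insert:
  assumes "inner_system P F" "puncture_arc (- ball 0 1 \<union> \<Union>F) (P - \<Union>F) A"
  shows "inner_system P (insert A F)" "A \<notin> F"
proof -
  obtain p q where pq: "arc_between p q A" "A \<inter> (P - \<Union>F) = {p, q}"
    using assms(2) unfolding puncture_arc_def by metis
  have off: "A \<inter> \<Union>F = {}" "A \<inter> - ball 0 1 = {}"
    using puncture_arc_off[OF assms(2)] by auto
  then have "A \<inter> P = {p, q}"
    using pq(2) by auto
  then have "puncture_arc (- ball 0 1) P A"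
    unfolding puncture_arc_def using pq(1) off by metis
  moreover have "disjnt A B \<and> disjnt B A" if "B \<in> F" for B
    using off(1) that unfolding disjnt_def by auto
  ultimately show "inner_system P (insert A F)"
    using assms(1) unfolding inner_system_def by (auto simp: pairwise_insert)
  show "A \<notin> F"
    using off(1) arc_between_ends(1)[OF pq(1)] by auto
qed

lemma inner_system_member:
  assumes "inner_system P S" "F \<subseteq> S" "A \<in> S - F"
  shows "puncture_arc (- ball 0 1 \<union> \<Union>F) (P - \<Union>F) A"
proof -
  have A: "puncture_arc (- ball 0 1) P A"
    using assms unfolding inner_system_def by auto
  then obtain p q where pq: "arc_between p q A" "A \<inter> P = {p, q}"
    unfolding puncture_arc_def by metis
  have "A \<inter> B = {}" if "B \<in> F" for B
    using assms that unfolding inner_system_def pairwise_def disjnt_def by (metis DiffD1 DiffD2 subsetD)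
  then have "A \<inter> \<Union>F = {}"
    by auto
  moreover from this have "A \<inter> (P - \<Union>F) = {p, q}"
    using pq(2) by auto
  ultimately show ?thesis
    unfolding puncture_arc_def using pq(1) puncture_arc_off[OF A] by auto
qed

text \<open>
  Each arc of the system uses two punctures and the system does not separate the disk, so as long as two
  punctures are free they can be joined by a further arc.
\<close>

lemma inner_system_extend:
  assumes "finite P" "P \<subseteq> ball 0 1" "2 * k \<le> card P"
  shows "inner_system P F \<Longrightarrow> card F \<le> k \<Longrightarrow> \<exists>S. inner_system P S \<and> F \<subseteq> S \<and> card S = k"
proof (induction "k - card F" arbitrary: F)
  case 0
  then show ?case
    by (metis diff_is_0_eq le_antisym subset_refl)
next
  case (Suc m)
  interpret planar_region "- ball 0 1 \<union> \<Union>F" "P - \<Union>F"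
    using inner_system_planar_region Suc.prems(1) assms(1,2) .
  have "card (P - \<Union>F - {}) \<ge> 2"
    using inner_system_card_free[OF Suc.prems(1) assms(1)] assms(3) Suc.hyps(2) by simp
  then obtain A where "puncture_arc (- ball 0 1 \<union> \<Union>F) (P - \<Union>F) A"
    using exists_arc_avoiding[of "{}"] by auto
  note A = inner_system_insert[OF Suc.prems(1) this]
  have "card (insert A F) = Suc (card F)"
    using A Suc.prems(1) unfolding inner_system_def by simp
  then obtain S where "inner_system P S" "insert A F \<subseteq> S" "card S = k"
    using Suc.hyps(1)[of "insert A F"] Suc.hyps(2) A(1) by fastforce
  then show ?case
    by auto
qed

text \<open>
  Downward induction on the size of the common part \<open>F\<close>. If only one arc is not in \<open>F\<close>, a single
  exchange suffices. Otherwise at least five punctures are free of \<open>F\<close>, so an arc of \<open>S\<close> and an arc of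
  \<open>T\<close> outside \<open>F\<close> are linked by a chain of arcs off \<open>F\<close>, consecutive ones being disjoint. Two
  consecutive arcs lie, together with \<open>F\<close>, in a common system with \<open>k\<close> arcs; and systems that contain
  \<open>F\<close> and the same member of the chain are linked by the induction hypothesis.
\<close>

lemma exchange_connected_over:
  assumes P: "finite P" "P \<subseteq> ball 0 1" "2 * k < card P"
  shows "card F < k \<Longrightarrow> inner_system P S \<Longrightarrow> inner_system P T \<Longrightarrow> card S = k \<Longrightarrow> card T = k \<Longrightarrow>
    F \<subseteq> S \<Longrightarrow> F \<subseteq> T \<Longrightarrow> (S, T) \<in> (exchange k P)\<^sup>*"
proof (induction "k - card F" arbitrary: F S T rule: less_induct)
  case less
  note S = less.prems(2,4,6) and T = less.prems(3,5,7)
  have fin: "finite S" "finite T" "finite F"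
    using S T unfolding inner_system_def by (auto intro: finite_subset)
  have F: "inner_system P F"
    using inner_system_subset S by metis
  show ?case
  proof (cases "card F = k - 1")
    case True
    have "k - 1 \<le> card (S \<inter> T)"
      using card_mono[of "S \<inter> T" F] fin S(3) T(3) True by simp
    moreover have "S = T" if "card (S \<inter> T) \<ge> k"
      using card_subset_eq[of S "S \<inter> T"] card_subset_eq[of T "S \<inter> T"] fin S(2) T(2) that
        card_mono[of S "S \<inter> T"] by auto
    ultimately have "S = T \<or> card (S \<inter> T) = k - 1"
      by linarith
    then show ?thesis
      using S T unfolding exchange_def by auto
  next
    case False
    define K where "K = - ball 0 1 \<union> \<Union>F"
    define Q where "Q = P - \<Union>F"
    interpret planar_region K Q
      unfolding K_def Q_def using inner_system_planar_region F P(1,2) .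
    have Q5: "card Q \<ge> 5"
      using inner_system_card_free[OF F P(1)] P(3) False less.prems(1) unfolding Q_def by simp
    have "\<not> S \<subseteq> F" "\<not> T \<subseteq> F"
      using less.prems(1) S(2) T(2) card_mono[OF fin(3)] by (metis leD)+
    then obtain A B where A: "A \<in> S - F" and B: "B \<in> T - F"
      by auto
    have arcs: "puncture_arc K Q A" "puncture_arc K Q B"
      unfolding K_def Q_def using inner_system_member S T A B by metis+
    have same_arc: "(U, V) \<in> (exchange k P)\<^sup>*"
      if C: "puncture_arc K Q C" and U: "inner_system P U" "card U = k" "insert C F \<subseteq> U"
        and V: "inner_system P V" "card V = k" "insert C F \<subseteq> V" for C U V
    proof (rule less.hyps)
      have "card (insert C F) = Suc (card F)"
        using inner_system_insert(2)[OF F] C fin(3) unfolding K_def Q_def by simp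
      then show "k - card (insert C F) < k - card F" "card (insert C F) < k"
        using less.prems(1) False by simp_all
    qed (use U V in auto)
    have "(A, B) \<in> disjointness\<^sup>*"
      using disjointness_connected[OF Q5 arcs] .
    then have "\<forall>V. inner_system P V \<and> card V = k \<and> insert B F \<subseteq> V \<longrightarrow> (S, V) \<in> (exchange k P)\<^sup>*"
    proof (induction rule: rtrancl_induct)
      case base
      then show ?case
        using same_arc[OF arcs(1) S(1,2)] A S(3) by simp
    next
      case (step C D)
      have CD: "puncture_arc K Q C" "puncture_arc K Q D" "C \<inter> D = {}"
        using step.hyps(2) unfolding disjointness_def by auto
      have FC: "inner_system P (insert C F)" "C \<notin> F"
        using inner_system_insert[OF F] CD(1) unfolding K_def Q_def by metis+
      have FD: "inner_system P (insert D F)" "D \<notin> F"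
        using inner_system_insert[OF F] CD(2) unfolding K_def Q_def by metis+
      have "C \<noteq> D"
        using CD puncture_arc_card_ends[OF CD(1)] by auto
      have "disjnt C X \<and> disjnt X C" if "X \<in> insert D F" for X
        using that CD(3) FC unfolding inner_system_def pairwise_insert by (auto simp: disjnt_def)
      then have "inner_system P (insert C (insert D F))"
        using FC(1) FD(1) unfolding inner_system_def by (auto simp: pairwise_insert)
      moreover have "card (insert C (insert D F)) \<le> k"
        using FC(2) FD(2) \<open>C \<noteq> D\<close> fin(3) less.prems(1) False by simp
      ultimately obtain U where U: "inner_system P U" "insert C (insert D F) \<subseteq> U" "card U = k"
        using inner_system_extend[OF P(1,2)] P(3) by (metis less_imp_le)
      then have SU: "(S, U) \<in> (exchange k P)\<^sup>*"
        using step.IH by simp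
      have "(U, V) \<in> (exchange k P)\<^sup>*"
        if "inner_system P V" "card V = k" "insert D F \<subseteq> V" for V
        using same_arc[OF CD(2)] U that by simp
      then show ?case
        using rtrancl_trans[OF SU] by blast
    qed
    then show ?thesis
      using T B by simp
  qed
qed

theorem exchange_connected:
  assumes "finite P" "P \<subseteq> ball 0 1" "0 < k" "2 * k < card P"
    and "inner_system P S" "card S = k" "inner_system P T" "card T = k"
  shows "(S, T) \<in> (exchange k P)\<^sup>*"
  using exchange_connected_over[of P k "{}" S T] assms by simp

section \<open>Isotopy of arcs\<close>

lemma param_arc_cong:
  assumes "\<And>x. x \<in> {0..1} \<Longrightarrow> f x = g x"
  shows "param_arc P f \<longleftrightarrow> param_arc P g"
proof -
  have "continuous_on {0..1} f \<longleftrightarrow> continuous_on {0..1} g" "inj_on f {0..1} \<longleftrightarrow> inj_on g {0..1}"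
    "f ` {0..1} = g ` {0..1}"
    using assms by (auto intro!: continuous_on_cong inj_on_cong image_cong)
  then show ?thesis
    using assms unfolding param_arc_def arc_def path_def path_image_def pathstart_def pathfinish_def
    by simp
qed

lemma homotopic_param_arcsI:
  fixes h :: "real \<times> real \<Rightarrow> complex"
  assumes "continuous_on ({0..1} \<times> {0..1}) h" "\<And>t. t \<in> {0..1} \<Longrightarrow> param_arc P (\<lambda>x. h (t, x))"
    and "\<And>x. x \<in> {0..1} \<Longrightarrow> h (0, x) = p x" "\<And>x. x \<in> {0..1} \<Longrightarrow> h (1, x) = q x"
  shows "homotopic_with_canon (param_arc P) {0..1} (cball 0 1) p q"
proof -
  have "h ` ({0..1} \<times> {0..1}) \<subseteq> cball 0 1"
    using assms(2) unfolding param_arc_def path_image_def by fastforce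
  then have "continuous_map (prod_topology (top_of_set {0..1::real}) (top_of_set {0..1::real}))
      (top_of_set (cball 0 1)) h"
    using assms(1) by (simp add: subtopology_Times[symmetric] image_subset_iff_funcset)
  then have ex: "\<exists>h. continuous_map (prod_topology (top_of_set {0..1::real}) (top_of_set {0..1::real}))
      (top_of_set (cball 0 1)) h \<and> (\<forall>x\<in>topspace (top_of_set {0..1}). h (0, x) = p x) \<and>
      (\<forall>x\<in>topspace (top_of_set {0..1}). h (1, x) = q x) \<and> (\<forall>t\<in>{0..1}. param_arc P (\<lambda>x. h (t, x)))"
    using assms(2-4) by (intro exI[of _ h]) simp
  have cong: "param_arc P f \<longleftrightarrow> param_arc P g"
    if "\<And>x. x \<in> topspace (top_of_set {0..1}) \<Longrightarrow> f x = g x" for f g :: "real \<Rightarrow> complex"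
    using that by (intro param_arc_cong) simp
  show ?thesis
    by (rule iffD2[OF homotopic_with ex]) (rule cong)
qed

lemma homotopic_param_arcsD:
  assumes "homotopic_with_canon (param_arc P) {0..1} (cball 0 1) p q"
  shows "\<exists>h :: real \<times> real \<Rightarrow> complex. continuous_on ({0..1} \<times> {0..1}) h \<and>
    (\<forall>t\<in>{0..1}. param_arc P (\<lambda>x. h (t, x))) \<and> (\<forall>x. h (0, x) = p x) \<and> (\<forall>x. h (1, x) = q x)"
proof -
  obtain h where h: "continuous_map (prod_topology (top_of_set {0..1::real}) (top_of_set {0..1::real}))
      (top_of_set (cball 0 1)) h"
    and "\<forall>x. h (0, x) = p x" "\<forall>x. h (1, x) = q x" "\<forall>t\<in>{0..1}. param_arc P (\<lambda>x. h (t, x))"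
    using assms unfolding homotopic_with_def by auto
  moreover have "continuous_on ({0..1} \<times> {0..1}) h"
    using h by (simp add: subtopology_Times[symmetric])
  ultimately show ?thesis
    by auto
qed

lemma param_arc_reparam:
  assumes "param_arc P p" "continuous_on {0..1} \<phi>" "strict_mono_on {0..1} \<phi>" "\<phi> 0 = 0" "\<phi> 1 = 1"
  shows "param_arc P (\<lambda>x. p (\<phi> x))"
proof -
  have into: "\<phi> x \<in> {0..1}" if "x \<in> {0..1}" for x
    using strict_mono_on_leD[OF assms(3), of 0 x] strict_mono_on_leD[OF assms(3), of x 1] assms(4,5) that
    by simp
  have p: "continuous_on {0..1} p" "inj_on p {0..1}" "p ` {0..1} \<subseteq> cball 0 1"
    "p ` {0..1} \<inter> P = {p 0, p 1}"
    using assms(1) unfolding param_arc_def arc_def path_def path_image_def pathstart_def pathfinish_def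
    by auto
  have cont: "continuous_on {0..1} (\<lambda>x. p (\<phi> x))"
    by (rule continuous_on_compose2[OF p(1) assms(2)]) (use into in auto)
  have inj: "inj_on (\<lambda>x. p (\<phi> x)) {0..1}"
    using comp_inj_on[OF strict_mono_on_imp_inj_on[OF assms(3)] inj_on_subset[OF p(2)]] into
    by (auto simp: comp_def image_subset_iff)
  have sub: "(\<lambda>x. p (\<phi> x)) ` {0..1} \<subseteq> p ` {0..1}"
    using into by auto
  have "p 0 \<in> (\<lambda>x. p (\<phi> x)) ` {0..1}" "p 1 \<in> (\<lambda>x. p (\<phi> x)) ` {0..1}"
    using imageI[of 0 "{0..1}" "\<lambda>x. p (\<phi> x)"] imageI[of 1 "{0..1}" "\<lambda>x. p (\<phi> x)"] assms(4,5)
    by simp_all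
  then have "(\<lambda>x. p (\<phi> x)) ` {0..1} \<inter> P = {p 0, p 1}"
    using sub p(4) by auto
  then show ?thesis
    using cont inj sub p(3) assms(4,5)
    unfolding param_arc_def arc_def path_def path_image_def pathstart_def pathfinish_def by auto
qed

text \<open>
  Two parametrisations of an arc with the same starting point differ by an increasing homeomorphism of
  the unit interval, and the convex combinations of it with the identity are again increasing
  homeomorphisms.
\<close>

lemma homotopic_param_arcs_same_image:
  assumes p: "param_arc P p" and q: "param_arc P q"
    and same: "path_image p = path_image q" "pathstart p = pathstart q"
  shows "homotopic_with_canon (param_arc P) {0..1} (cball 0 1) p q"
proof -
  have arcs: "arc p" "arc q"
    using p q unfolding param_arc_def by auto
  obtain p' where p': "homeomorphism {0..1} (path_image p) p p'"
    using homeomorphism_arc[OF arcs(1)] .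
  define \<phi> where "\<phi> = p' \<circ> q"
  have p\<phi>: "p (\<phi> x) = q x" if "x \<in> {0..1}" for x
    using homeomorphism_apply2[OF p'] same(1) that unfolding \<phi>_def path_image_def by auto
  have ends: "pathfinish p = pathfinish q"
    using p q same arc_distinct_ends[OF arcs(1)] arc_distinct_ends[OF arcs(2)]
    unfolding param_arc_def by (metis doubleton_eq_iff)
  have p'p: "p' (p x) = x" if "x \<in> {0..1}" for x
    using homeomorphism_apply1[OF p' that] .
  have \<phi>01: "\<phi> 0 = 0" "\<phi> 1 = 1"
    using p'p[of 0] p'p[of 1] same(2) ends unfolding \<phi>_def pathstart_def pathfinish_def by auto
  have cont: "continuous_on {0..1} \<phi>"
    unfolding \<phi>_def using arcs(2) homeomorphism_cont2[OF p'] same(1)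
    by (intro continuous_on_compose) (auto simp: arc_def path_def path_image_def)
  have "inj_on \<phi> {0..1}"
    using arcs(2) p\<phi> unfolding arc_def inj_on_def by metis
  then have "strict_mono_on {0..1} \<phi> \<or> strict_antimono_on {0..1} \<phi>"
    using injective_eq_monotone_map[of "{0..1}" \<phi>] cont is_interval_cc by blast
  moreover have "\<not> strict_antimono_on {0..1} \<phi>"
    using \<phi>01 monotone_onD[of "{0..1}" "(<)" "(>)" \<phi> 0 1] by auto
  ultimately have mono: "strict_mono_on {0..1} \<phi>"
    by blast
  have into: "\<phi> x \<in> {0..1}" if "x \<in> {0..1}" for x
    using strict_mono_on_leD[OF mono, of 0 x] strict_mono_on_leD[OF mono, of x 1] \<phi>01 that by simp
  define \<psi> where "\<psi> t x = (1 - t) * x + t * \<phi> x" for t x :: real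
  have \<psi>_into: "\<psi> t x \<in> {0..1}" if "t \<in> {0..1}" "x \<in> {0..1}" for t x
    using convexD[OF convex_real_interval(5)[of 0 1] that(2) into[OF that(2)], of "1 - t" t] that(1)
    unfolding \<psi>_def by simp
  show ?thesis
  proof (rule homotopic_param_arcsI[where h = "\<lambda>(t, x). p (\<psi> t x)"])
    have "continuous_on ({0..1} \<times> {0..1}) (\<lambda>y. \<phi> (snd y))"
      by (rule continuous_on_compose2[OF cont]) (auto intro: continuous_intros)
    then have "continuous_on ({0..1} \<times> {0..1}) (\<lambda>y. \<psi> (fst y) (snd y))"
      unfolding \<psi>_def by (intro continuous_intros)
    moreover have "continuous_on {0..1} p"
      using arcs(1) unfolding arc_def path_def by simp
    ultimately show "continuous_on ({0..1} \<times> {0..1}) (\<lambda>(t, x). p (\<psi> t x))"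
      unfolding case_prod_beta
      using continuous_on_compose2[of "{0..1}" p "{0..1} \<times> {0..1}" "\<lambda>y. \<psi> (fst y) (snd y)"] \<psi>_into
      by (simp add: image_subset_iff)
  next
    fix t :: real assume t: "t \<in> {0..1}"
    have "continuous_on {0..1} (\<psi> t)"
      unfolding \<psi>_def using cont by (intro continuous_intros)
    moreover have "strict_mono_on {0..1} (\<psi> t)"
    proof (rule strict_mono_onI)
      fix x y :: real assume xy: "x \<in> {0..1}" "y \<in> {0..1}" "x < y"
      then have "\<phi> x < \<phi> y"
        using strict_mono_onD[OF mono] by blast
      then have "0 < (1 - t) * (y - x) + t * (\<phi> y - \<phi> x)"
        using t xy(3) by (cases "t = 0") (auto intro!: add_nonneg_pos mult_nonneg_nonneg mult_pos_pos)
      then show "\<psi> t x < \<psi> t y"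
        unfolding \<psi>_def by (simp add: algebra_simps)
    qed
    ultimately show "param_arc P (\<lambda>x. case (t, x) of (t, x) \<Rightarrow> p (\<psi> t x))"
      using param_arc_reparam[OF p, of "\<psi> t"] \<phi>01 by (simp add: \<psi>_def)
  next
    fix x :: real assume "x \<in> {0..1}"
    then show "(case (0, x) of (t, x) \<Rightarrow> p (\<psi> t x)) = p x" "(case (1, x) of (t, x) \<Rightarrow> p (\<psi> t x)) = q x"
      using p\<phi> by (simp_all add: \<psi>_def)
  qed
qed

lemma param_arc_reversepath: "param_arc P g \<Longrightarrow> param_arc P (reversepath g)"
  unfolding param_arc_def by (auto simp: arc_reversepath)

lemma homotopic_param_arcs_reversepath:
  assumes "homotopic_with_canon (param_arc P) {0..1} (cball 0 1) p q"
  shows "homotopic_with_canon (param_arc P) {0..1} (cball 0 1) (reversepath p) (reversepath q)"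
proof -
  have "continuous_map (top_of_set {0..1}) (top_of_set {0..1}) (\<lambda>x. 1 - x :: real)"
    by (auto intro!: continuous_intros)
  moreover have "param_arc P (j \<circ> (\<lambda>x. 1 - x))" if "param_arc P j" for j
    using param_arc_reversepath[OF that] by (simp add: reversepath_def comp_def)
  ultimately have "homotopic_with_canon (param_arc P) {0..1} (cball 0 1)
      (p \<circ> (\<lambda>x. 1 - x)) (q \<circ> (\<lambda>x. 1 - x))"
    using homotopic_with_compose_continuous_map_right[OF assms] by blast
  then show ?thesis
    by (simp add: reversepath_def comp_def)
qed

lemma arc_isotopyI:
  "homotopic_with_canon (param_arc P) {0..1} (cball 0 1) p q \<Longrightarrow>
    (path_image p, path_image q) \<in> arc_isotopy P"
  by (auto simp: arc_isotopy_def)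

lemma arc_isotopyE:
  assumes "(a, b) \<in> arc_isotopy P"
  obtains p q where "homotopic_with_canon (param_arc P) {0..1} (cball 0 1) p q"
    "a = path_image p" "b = path_image q"
  using assms by (auto simp: arc_isotopy_def)

lemma arc_isotopy_sym: "(a, b) \<in> arc_isotopy P \<Longrightarrow> (b, a) \<in> arc_isotopy P"
  by (elim arc_isotopyE) (simp add: arc_isotopyI homotopic_with_symD)

lemma arc_isotopy_refl:
  assumes "a \<in> disk_arcs P"
  shows "(a, a) \<in> arc_isotopy P"
proof -
  obtain g where g: "param_arc P g" "a = path_image g"
    using assms by (auto simp: disk_arcs_def)
  then show ?thesis
    using arc_isotopyI[OF homotopic_param_arcs_same_image[OF g(1) g(1)]] by simp
qed

text \<open>
  The two isotopies may use different parametrisations of the middle arc. Up to reversing the first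
  isotopy, these are homotopic by the preceding lemmas.
\<close>

lemma arc_isotopy_trans:
  assumes "(a, b) \<in> arc_isotopy P" "(b, c) \<in> arc_isotopy P"
  shows "(a, c) \<in> arc_isotopy P"
proof -
  let ?H = "homotopic_with_canon (param_arc P) {0..1} (cball 0 1)"
  obtain p q where pq: "?H p q" "a = path_image p" "b = path_image q"
    using arc_isotopyE[OF assms(1)] .
  obtain q' r where qr: "?H q' r" "b = path_image q'" "c = path_image r"
    using arc_isotopyE[OF assms(2)] .
  have q: "param_arc P q" and q': "param_arc P q'"
    using homotopic_with_imp_property[OF pq(1)] homotopic_with_imp_property[OF qr(1)] by simp_all
  then have "{pathstart q, pathfinish q} = {pathstart q', pathfinish q'}"
    using pq(3) qr(2) unfolding param_arc_def by simp
  then consider "pathstart q = pathstart q'" | "pathstart (reversepath q) = pathstart q'"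
    by (auto simp: doubleton_eq_iff)
  then show ?thesis
  proof cases
    case 1
    then have "?H q q'"
      using homotopic_param_arcs_same_image[OF q q'] pq(3) qr(2) by simp
    then have "?H p r"
      by (rule homotopic_with_trans[OF homotopic_with_trans[OF pq(1)] qr(1)])
    then show ?thesis
      using arc_isotopyI pq(2) qr(3) by simp
  next
    case 2
    then have "?H (reversepath q) q'"
      using homotopic_param_arcs_same_image[OF param_arc_reversepath[OF q] q'] pq(3) qr(2) by simp
    then have "?H (reversepath p) r"
      by (rule homotopic_with_trans[OF
            homotopic_with_trans[OF homotopic_param_arcs_reversepath[OF pq(1)]] qr(1)])
    then show ?thesis
      using arc_isotopyI[of P "reversepath p" r] pq(2) qr(3) by simp
  qed
qed

lemma isotopy_class_eq: "(a, b) \<in> arc_isotopy P \<Longrightarrow> isotopy_class P a = isotopy_class P b"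
  unfolding isotopy_class_def Image_def
  using arc_isotopy_trans[of a b P] arc_isotopy_trans[of b a P] arc_isotopy_sym[of a b P]
  by (intro Collect_cong) auto

text \<open>
  During an isotopy each end moves continuously within the finite set \<open>P\<close>, so it does not move.
\<close>

lemma arc_isotopy_same_ends:
  assumes "finite P" "(a, b) \<in> arc_isotopy P"
  shows "a \<inter> P = b \<inter> P"
proof -
  obtain p q where pq: "homotopic_with_canon (param_arc P) {0..1} (cball 0 1) p q"
    "a = path_image p" "b = path_image q"
    using arc_isotopyE[OF assms(2)] .
  obtain h :: "real \<times> real \<Rightarrow> complex" where h: "continuous_on ({0..1} \<times> {0..1}) h"
    "\<And>t. t \<in> {0..1} \<Longrightarrow> param_arc P (\<lambda>x. h (t, x))" "\<And>x. h (0, x) = p x" "\<And>x. h (1, x) = q x"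
    using homotopic_param_arcsD[OF pq(1)] by auto
  have "p x = q x" if x: "x = 0 \<or> x = 1" for x
  proof -
    have "h (t, x) \<in> P" if "t \<in> {0..1}" for t
    proof -
      have "path_image (\<lambda>x. h (t, x)) \<inter> P = {h (t, 0), h (t, 1)}"
        using h(2)[OF that] unfolding param_arc_def pathstart_def pathfinish_def by simp
      then show ?thesis
        using x by auto
    qed
    then have inP: "(\<lambda>t. h (t, x)) ` {0..1} \<subseteq> P"
      by auto
    have "continuous_on {0..1} (\<lambda>t. h (t, x))"
      by (rule continuous_on_compose2[OF h(1)]) (use x in \<open>auto intro!: continuous_intros\<close>)
    then have "connected ((\<lambda>t. h (t, x)) ` {0..1})"
      by (intro connected_continuous_image) auto
    moreover have "finite ((\<lambda>t. h (t, x)) ` {0..1})"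
      using finite_subset[OF inP assms(1)] .
    ultimately have "(\<lambda>t. h (t, x)) ` {0..1} = {} \<or> (\<exists>c. (\<lambda>t. h (t, x)) ` {0..1} = {c})"
      by (simp add: connected_finite_iff_sing)
    then obtain c where "(\<lambda>t. h (t, x)) ` {0..1} = {c}"
      by auto
    then have "h (0, x) = c" "h (1, x) = c"
      using imageI[of 0 "{0..1}" "\<lambda>t. h (t, x)"] imageI[of 1 "{0..1}" "\<lambda>t. h (t, x)"] by auto
    then show ?thesis
      using h(3,4) by simp
  qed
  moreover have "a \<inter> P = {p 0, p 1}" "b \<inter> P = {q 0, q 1}"
    using homotopic_with_imp_property[OF pq(1)] pq(2,3)
    unfolding param_arc_def pathstart_def pathfinish_def by auto
  ultimately show ?thesis
    by simp
qed

section \<open>Representatives inside the open disk\<close>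

text \<open>
  An isotopy of the closed disk into itself that fixes the punctures and moves the boundary circle into
  the open disk. Let \<open>r < 1\<close> bound the norms of the punctures. Points of norm at most \<open>r\<close> stay; points
  of norm \<open>\<rho> \<ge> r\<close> move linearly in time to norm \<open>(\<rho> + r) / 2\<close> on their ray.
\<close>

lemma radial_push:
  assumes "finite P" "P \<subseteq> ball 0 1"
  obtains \<phi> :: "real \<Rightarrow> complex \<Rightarrow> complex" where
    "continuous_on ({0..1} \<times> cball 0 1) (\<lambda>(t, z). \<phi> t z)" "\<And>z. \<phi> 0 z = z"
    "\<And>t. t \<in> {0..1} \<Longrightarrow> inj_on (\<phi> t) (cball 0 1)"
    "\<And>t. t \<in> {0..1} \<Longrightarrow> \<phi> t ` cball 0 1 \<subseteq> cball 0 1" "\<phi> 1 ` cball 0 1 \<subseteq> ball 0 1"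
    "\<And>t z. z \<in> P \<Longrightarrow> \<phi> t z = z"
proof -
  define r where "r = Max (insert (1/2) (norm ` P))"
  have r: "0 < r" "r < 1" "\<And>z. z \<in> P \<Longrightarrow> norm z \<le> r"
  proof -
    have "1 / 2 \<le> r"
      unfolding r_def using assms(1) by (intro Max_ge) auto
    then show "0 < r"
      by simp
    show "r < 1"
      unfolding r_def using assms by (subst Max_less_iff) auto
    show "norm z \<le> r" if "z \<in> P" for z
      unfolding r_def using assms(1) that by (intro Max_ge) auto
  qed
  \<comment> \<open>the maximum avoids a division by zero at the origin, where the factor is 1\<close>
  define c where "c t z = 1 - t + t * ((1 + r / max r (norm z)) / 2)" for t and z :: complex
  define \<phi> where "\<phi> t z = complex_of_real (c t z) * z" for t z
  \<comment> \<open>the effect of \<open>\<phi> t\<close> on norms\<close>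
  define f where "f t \<rho> = (1 - t / 2) * \<rho> + t / 2 * min \<rho> r" for t \<rho> :: real
  have c_pos: "0 < c t z" if "t \<in> {0..1}" for t z
  proof -
    have "0 < (1 + r / max r (norm z)) / 2"
      using r(1) by (intro divide_pos_pos add_pos_pos) auto
    then show ?thesis
      using that unfolding c_def by (cases "t = 0") (auto intro: add_nonneg_pos mult_pos_pos)
  qed
  have c_norm: "c t z * norm z = f t (norm z)" for t z
    using r(1) unfolding c_def f_def by (cases "norm z \<le> r") (auto simp: max_def min_def field_simps)
  have norm_\<phi>: "norm (\<phi> t z) = f t (norm z)" if "t \<in> {0..1}" for t z
    using c_pos[OF that, of z] c_norm[of t z] unfolding \<phi>_def by (simp add: norm_mult)
  have f_mono: "f t x < f t y" if "t \<in> {0..1}" "x < y" for t x y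
  proof -
    have "(1 - t / 2) * x < (1 - t / 2) * y"
      using that by (intro mult_strict_left_mono) auto
    moreover have "t / 2 * min x r \<le> t / 2 * min y r"
      using that by (intro mult_left_mono) auto
    ultimately show ?thesis
      unfolding f_def by simp
  qed
  have f_le: "f t x \<le> x" if "t \<in> {0..1}" for t x
  proof -
    have "t / 2 * min x r \<le> t / 2 * x"
      using that by (intro mult_left_mono) auto
    then show ?thesis
      unfolding f_def by (simp add: algebra_simps)
  qed
  show thesis
  proof (rule that)
    have "continuous_on ({0..1} \<times> cball 0 1) (\<lambda>y. complex_of_real (c (fst y) (snd y)) * snd y)"
      unfolding c_def using r(1) by (intro continuous_intros) (auto simp: max_def)
    then show "continuous_on ({0..1} \<times> cball 0 1) (\<lambda>(t, z). \<phi> t z)"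
      unfolding \<phi>_def by (simp add: case_prod_beta)
    show "\<phi> 0 z = z" for z
      unfolding \<phi>_def c_def by simp
    show "inj_on (\<phi> t) (cball 0 1)" if t: "t \<in> {0..1}" for t
    proof (rule inj_onI)
      fix z w assume eq: "\<phi> t z = \<phi> t w"
      then have "f t (norm z) = f t (norm w)"
        using norm_\<phi>[OF t] by metis
      then have "norm z = norm w"
        using f_mono[OF t] by (metis less_irrefl linorder_neqE_linordered_idom)
      then have "c t z = c t w"
        unfolding c_def by simp
      then show "z = w"
        using eq c_pos[OF t, of w] unfolding \<phi>_def by simp
    qed
    show "\<phi> t ` cball 0 1 \<subseteq> cball 0 1" if t: "t \<in> {0..1}" for t
    proof (rule image_subsetI)
      fix z :: complex assume "z \<in> cball 0 1"
      then show "\<phi> t z \<in> cball 0 1"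
        using norm_\<phi>[OF t, of z] f_le[OF t, of "norm z"] by simp
    qed
    show "\<phi> 1 ` cball 0 1 \<subseteq> ball 0 1"
    proof (rule image_subsetI)
      fix z :: complex assume "z \<in> cball 0 1"
      then have "f 1 (norm z) < 1"
        using r(2) unfolding f_def by (auto simp: min_def)
      then show "\<phi> 1 z \<in> ball 0 1"
        using norm_\<phi>[of 1 z] by simp
    qed
    show "\<phi> t z = z" if "z \<in> P" for t z
      using r(1) r(3)[OF that] unfolding \<phi>_def c_def by (simp add: max_def)
  qed
qed

text \<open>
  An injective map that fixes the punctures sends no other point to a puncture.
\<close>

lemma push_param_arc:
  assumes g: "param_arc P g" and "P \<subseteq> cball 0 1"
    and \<phi>: "continuous_on (cball 0 1) \<phi>" "inj_on \<phi> (cball 0 1)" "\<phi> ` cball 0 1 \<subseteq> cball 0 1"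
    and fixes_P: "\<And>z. z \<in> P \<Longrightarrow> \<phi> z = z"
  shows "param_arc P (\<phi> \<circ> g)"
proof -
  have g: "arc g" "path_image g \<subseteq> cball 0 1" "path_image g \<inter> P = {pathstart g, pathfinish g}"
    using g unfolding param_arc_def by auto
  have "continuous_on (path_image g) \<phi>" "inj_on \<phi> (path_image g)"
    using \<phi>(1,2) g(2) by (auto intro: continuous_on_subset inj_on_subset)
  then have "arc (\<phi> \<circ> g)"
    using g(1) unfolding arc_def by (auto intro: path_continuous_image comp_inj_on simp: path_image_def)
  moreover have "\<phi> ` path_image g \<inter> P = path_image g \<inter> P"
  proof
    show "\<phi> ` path_image g \<inter> P \<subseteq> path_image g \<inter> P"
    proof
      fix z assume "z \<in> \<phi> ` path_image g \<inter> P"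
      then obtain w where w: "w \<in> path_image g" "z = \<phi> w" "z \<in> P"
        by blast
      then have "\<phi> w = \<phi> z"
        using fixes_P by simp
      then have "w = z"
        using inj_onD[OF \<phi>(2)] w g(2) assms(2) by blast
      then show "z \<in> path_image g \<inter> P"
        using w by simp
    qed
    show "path_image g \<inter> P \<subseteq> \<phi> ` path_image g \<inter> P"
      using fixes_P by (force intro: image_eqI)
  qed
  moreover have "\<phi> (pathstart g) = pathstart g" "\<phi> (pathfinish g) = pathfinish g"
    using g(3) fixes_P by auto
  moreover have "\<phi> ` path_image g \<subseteq> cball 0 1"
    using image_mono[OF g(2)] \<phi>(3) by (rule subset_trans)
  ultimately show ?thesis
    using g(3) unfolding param_arc_def
    by (simp add: path_image_compose pathstart_compose pathfinish_compose)
qed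

text \<open>
  The radial isotopy moves a system off the boundary circle without changing the classes of its arcs.
  The ends of the \<open>k\<close> arcs number \<open>2 * k\<close>, so no two arcs share an end, and the arcs are disjoint as
  sets.
\<close>

lemma inner_representatives:
  assumes P: "finite P" "P \<subseteq> ball 0 1" and S: "arc_system k P S"
  obtains T where "inner_system P T" "card T = k" "isotopy_class P ` T = isotopy_class P ` S"
proof -
  obtain \<phi> :: "real \<Rightarrow> complex \<Rightarrow> complex" where \<phi>:
    "continuous_on ({0..1} \<times> cball 0 1) (\<lambda>(t, z). \<phi> t z)" "\<And>z. \<phi> 0 z = z"
    "\<And>t. t \<in> {0..1} \<Longrightarrow> inj_on (\<phi> t) (cball 0 1)"
    "\<And>t. t \<in> {0..1} \<Longrightarrow> \<phi> t ` cball 0 1 \<subseteq> cball 0 1" "\<phi> 1 ` cball 0 1 \<subseteq> ball 0 1"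
    "\<And>t z. z \<in> P \<Longrightarrow> \<phi> t z = z"
    using radial_push[OF P] by blast
  have P': "P \<subseteq> cball 0 1"
    using P(2) by auto
  have S': "finite S" "card S = k" "S \<subseteq> disk_arcs P"
    "pairwise (\<lambda>a b. disjnt (a - P) (b - P)) S" "card (\<Union>a\<in>S. a \<inter> P) = 2 * k"
    using S unfolding arc_system_def by auto
  have push: "param_arc P (\<phi> t \<circ> g)" if "param_arc P g" "t \<in> {0..1}" for g t
  proof (rule push_param_arc[OF that(1) P' _ \<phi>(3,4)[OF that(2)] \<phi>(6)])
    have "continuous_on (cball 0 1) (\<lambda>z. (\<lambda>(t, z). \<phi> t z) (t, z))"
      by (rule continuous_on_compose2[OF \<phi>(1)]) (use that(2) in \<open>auto intro!: continuous_intros\<close>)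
    then show "continuous_on (cball 0 1) (\<phi> t)"
      by simp
  qed
  have arcs: "puncture_arc (- ball 0 1) P (\<phi> 1 ` a)" "(a, \<phi> 1 ` a) \<in> arc_isotopy P"
    "card (a \<inter> P) = 2" "a \<subseteq> cball 0 1" if "a \<in> S" for a
  proof -
    have "a \<in> disk_arcs P"
      using S'(3) that by blast
    then obtain g where g: "param_arc P g" "a = path_image g"
      by (auto simp: disk_arcs_def)
    have im: "\<phi> 1 ` a = path_image (\<phi> 1 \<circ> g)"
      using g(2) by (simp add: path_image_compose)
    have g1: "param_arc P (\<phi> 1 \<circ> g)"
      using push[OF g(1)] by simp
    show sub: "a \<subseteq> cball 0 1"
      using g unfolding param_arc_def by simp
    have "\<phi> 1 ` a \<subseteq> ball 0 1"
      using sub \<phi>(5) by blast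
    then show "puncture_arc (- ball 0 1) P (\<phi> 1 ` a)"
      using g1 im unfolding puncture_arc_def param_arc_def arc_between_def by auto
    have "homotopic_with_canon (param_arc P) {0..1} (cball 0 1) g (\<phi> 1 \<circ> g)"
    proof (rule homotopic_param_arcsI[where h = "\<lambda>(t, x). \<phi> t (g x)"])
      have cont_g: "continuous_on {0..1} g" and im_g: "g ` {0..1} \<subseteq> cball 0 1"
        using g(1) unfolding param_arc_def arc_def path_def path_image_def by auto
      have "continuous_on ({0..1::real} \<times> {0..1}) (\<lambda>y. g (snd y))"
        by (rule continuous_on_compose2[OF cont_g]) (auto intro!: continuous_intros)
      then have "continuous_on ({0..1::real} \<times> {0..1}) (\<lambda>y. (fst y, g (snd y)))"
        by (intro continuous_intros)
      then have "continuous_on ({0..1} \<times> {0..1}) (\<lambda>y. (\<lambda>(t, z). \<phi> t z) (fst y, g (snd y)))"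
        by (rule continuous_on_compose2[OF \<phi>(1)]) (use im_g in auto)
      then show "continuous_on ({0..1} \<times> {0..1}) (\<lambda>(t, x). \<phi> t (g x))"
        by (simp add: case_prod_beta)
      show "param_arc P (\<lambda>x. case (t, x) of (t, x) \<Rightarrow> \<phi> t (g x))" if "t \<in> {0..1}" for t
        using push[OF g(1) that] by (simp add: comp_def)
    qed (use \<phi>(2) in auto)
    then show "(a, \<phi> 1 ` a) \<in> arc_isotopy P"
      using arc_isotopyI g(2) im by simp
    show "card (a \<inter> P) = 2"
      using g arc_distinct_ends unfolding param_arc_def by (auto simp: card_2_iff)
  qed
  have disj: "a \<inter> b = {}" if ab: "a \<in> S" "b \<in> S" "a \<noteq> b" for a b
  proof (rule ccontr)
    assume "a \<inter> b \<noteq> {}"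
    then obtain x where x: "x \<in> a" "x \<in> b"
      by blast
    then have "x \<in> P"
      using S'(4) ab unfolding pairwise_def disjnt_def by auto
    have "(\<Union>c\<in>S. c \<inter> P) \<subseteq> (a \<inter> P - {x}) \<union> (\<Union>c\<in>S - {a}. c \<inter> P)"
      using x ab by auto
    then have "card (\<Union>c\<in>S. c \<inter> P) \<le> card ((a \<inter> P - {x}) \<union> (\<Union>c\<in>S - {a}. c \<inter> P))"
      using P(1) S'(1) by (intro card_mono) auto
    also have "\<dots> \<le> card (a \<inter> P - {x}) + card (\<Union>c\<in>S - {a}. c \<inter> P)"
      by (rule card_Un_le)
    also have "card (a \<inter> P - {x}) = 1"
      using arcs(3)[OF ab(1)] x(1) \<open>x \<in> P\<close> by simp
    also have "card (\<Union>c\<in>S - {a}. c \<inter> P) \<le> (\<Sum>c\<in>S - {a}. card (c \<inter> P))"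
      using S'(1) by (intro card_UN_le) auto
    also have "\<dots> = (\<Sum>c\<in>S - {a}. 2)"
      using arcs(3) by (intro sum.cong) auto
    also have "\<dots> = 2 * (k - 1)"
      using S'(1,2) ab(1) by simp
    finally have "2 * k \<le> 1 + 2 * (k - 1)"
      using S'(5) by simp
    moreover have "k > 0"
      using S'(1,2) ab(1) by (auto simp: card_gt_0_iff)
    ultimately show False
      by simp
  qed
  have disj': "\<phi> 1 ` a \<inter> \<phi> 1 ` b = {}" if "a \<in> S" "b \<in> S" "a \<noteq> b" for a b
    using inj_on_image_Int[OF \<phi>(3)[of 1], of a b] arcs(4) disj that by simp
  have "inj_on ((`) (\<phi> 1)) S"
  proof (rule inj_onI)
    fix a b assume ab: "a \<in> S" "b \<in> S" "\<phi> 1 ` a = \<phi> 1 ` b"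
    have "a \<noteq> {}"
      using arcs(3)[OF ab(1)] by auto
    then show "a = b"
      using disj'[OF ab(1,2)] ab(3) by auto
  qed
  then have "card ((`) (\<phi> 1) ` S) = k"
    using S'(2) card_image by blast
  moreover have "inner_system P ((`) (\<phi> 1) ` S)"
    unfolding inner_system_def
  proof (intro conjI pairwise_imageI)
    show "disjnt (\<phi> 1 ` a) (\<phi> 1 ` b)" if "a \<in> S" "b \<in> S" "a \<noteq> b" for a b
      using disj' that unfolding disjnt_def by blast
  qed (use S'(1) arcs(1) in auto)
  moreover have "isotopy_class P ` (`) (\<phi> 1) ` S = isotopy_class P ` S"
    unfolding image_image using isotopy_class_eq[OF arcs(2)] by (intro image_cong) auto
  ultimately show thesis
    using that by blast
qed

section \<open>Edges of the complex\<close>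

lemma puncture_arc_in_disk_arcs:
  assumes "puncture_arc (- ball 0 1) P A"
  shows "A \<in> disk_arcs P"
proof -
  obtain g where g: "arc g" "path_image g = A" "A \<inter> P = {pathstart g, pathfinish g}"
    using assms unfolding puncture_arc_def arc_between_def by metis
  have "A \<subseteq> cball 0 1"
    using puncture_arc_off[OF assms] by (auto simp: disjoint_iff less_imp_le)
  then show ?thesis
    unfolding disk_arcs_def param_arc_def using g by auto
qed

lemma inner_system_arc_system:
  assumes "finite P" "inner_system P S"
  shows "arc_system (card S) P S"
proof -
  have "card (\<Union>A\<in>S. A \<inter> P) = (\<Sum>A\<in>S. card (A \<inter> P))"
    using assms unfolding inner_system_def pairwise_def disjnt_def
    by (intro card_UN_disjoint) auto
  also have "\<dots> = (\<Sum>A\<in>S. 2)"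
    using assms(2) puncture_arc_card_ends unfolding inner_system_def by (intro sum.cong) auto
  finally have "card (\<Union>A\<in>S. A \<inter> P) = 2 * card S"
    by simp
  moreover have "S \<subseteq> disk_arcs P"
    using assms(2) puncture_arc_in_disk_arcs unfolding inner_system_def by auto
  moreover have "pairwise (\<lambda>a b. disjnt (a - P) (b - P)) S"
    using assms(2) unfolding inner_system_def pairwise_def disjnt_def by auto
  ultimately show ?thesis
    using assms(2) unfolding arc_system_def inner_system_def by auto
qed

text \<open>
  Isotopic arcs have the same ends, and arcs of a system have none in common.
\<close>

lemma isotopy_class_inj_on:
  assumes "finite P" "inner_system P S"
  shows "inj_on (isotopy_class P) S"
proof (rule inj_onI)
  fix A B assume AB: "A \<in> S" "B \<in> S" "isotopy_class P A = isotopy_class P B"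
  then have arcs: "puncture_arc (- ball 0 1) P A" "puncture_arc (- ball 0 1) P B"
    using assms(2) unfolding inner_system_def by auto
  have "B \<in> isotopy_class P A"
    using arc_isotopy_refl[OF puncture_arc_in_disk_arcs[OF arcs(2)]] AB(3) unfolding isotopy_class_def by auto
  then have "A \<inter> P = B \<inter> P"
    using arc_isotopy_same_ends[OF assms(1)] unfolding isotopy_class_def by auto
  moreover have "A \<inter> P \<noteq> {}"
    using puncture_arc_card_ends[OF arcs(1)] by auto
  ultimately have "\<not> disjnt A B"
    unfolding disjnt_def by auto
  then show "A = B"
    using assms(2) AB(1,2) unfolding inner_system_def pairwise_def by auto
qed

text \<open>
  The unchanged arcs contribute \<open>k - 1\<close> common classes. The remaining two arcs may happen to be
  isotopic, in which case the exchange does not move the vertex at all.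
\<close>

lemma exchange_imp_edge:
  assumes "finite P" "(S, T) \<in> exchange k P"
  shows "isotopy_class P ` S = isotopy_class P ` T \<or>
    card (isotopy_class P ` S \<inter> isotopy_class P ` T) = k - 1"
proof -
  let ?V = "isotopy_class P ` S" and ?W = "isotopy_class P ` T"
  have S: "inner_system P S" "card S = k" and T: "inner_system P T" "card T = k"
    and ST: "card (S \<inter> T) = k - 1"
    using assms(2) unfolding exchange_def by auto
  have fin: "finite ?V" "finite ?W"
    using S(1) T(1) unfolding inner_system_def by auto
  have inj: "inj_on (isotopy_class P) S" "inj_on (isotopy_class P) T"
    using isotopy_class_inj_on assms(1) S(1) T(1) by blast+
  have card: "card ?V = k" "card ?W = k"
    using card_image[OF inj(1)] card_image[OF inj(2)] S(2) T(2) by simp_all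
  have "card (isotopy_class P ` (S \<inter> T)) = k - 1"
    using card_image[OF inj_on_subset[OF inj(1)], of "S \<inter> T"] ST by simp
  moreover have "card (isotopy_class P ` (S \<inter> T)) \<le> card (?V \<inter> ?W)"
    using fin by (intro card_mono) auto
  moreover have "?V = ?W" if "card (?V \<inter> ?W) \<ge> k"
  proof -
    have "?V \<inter> ?W = ?V" "?V \<inter> ?W = ?W"
      using card_seteq[OF fin(1) Int_lower1] card_seteq[OF fin(2) Int_lower2] card that by simp_all
    then show ?thesis
      by metis
  qed
  ultimately show ?thesis
    by linarith
qed

theorem theorem8p1:
  fixes k n :: nat and P :: "complex set"
  assumes "k \<ge> 2" and "n > 2 * k"
    and "finite P" and "card P = n" and "P \<subseteq> ball 0 1"
  shows "Digraph_Component.connected (with_proj (arc_tuple_complex k P))"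
proof -
  let ?V = "arc_tuples k P"
  define E where "E = parcs (mk_symmetric (with_proj (arc_tuple_complex k P)))"
  have vertex: "isotopy_class P ` S \<in> ?V" if "inner_system P S" "card S = k" for S
    using inner_system_arc_system[OF assms(3) that(1)] that(2) unfolding arc_tuples_def by auto
  have edge: "(X, Y) \<in> E" if "X \<in> ?V" "Y \<in> ?V" "card (X \<inter> Y) = k - 1" for X Y
  proof -
    have "(X, Y) \<in> parcs (arc_tuple_complex k P)"
      using that by (simp add: arc_tuple_complex_def)
    then show ?thesis
      unfolding E_def parcs_mk_symmetric with_proj_simps by (intro UN_I[of "(X, Y)"]) auto
  qed
  have step: "(isotopy_class P ` S, isotopy_class P ` T) \<in> rtrancl_on ?V E"
    if "inner_system P S" "card S = k" "(S, T) \<in> (exchange k P)\<^sup>*" for S T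
    using that(3)
  proof (induction rule: rtrancl_induct)
    case base
    show ?case
      using vertex[OF that(1,2)] by simp
  next
    case (step T U)
    have "inner_system P T" "card T = k" "inner_system P U" "card U = k"
      using step.hyps(2) unfolding exchange_def by auto
    then have TU: "isotopy_class P ` T \<in> ?V" "isotopy_class P ` U \<in> ?V"
      using vertex by auto
    show ?case
    proof (cases "isotopy_class P ` T = isotopy_class P ` U")
      case True
      then show ?thesis
        using step.IH by simp
    next
      case False
      then have "(isotopy_class P ` T, isotopy_class P ` U) \<in> E"
        using exchange_imp_edge[OF assms(3) step.hyps(2)] edge[OF TU] by simp
      then show ?thesis
        using step.IH TU(2) rtrancl_on_into_rtrancl_on by metis
    qed
  qed
  have "(X, Y) \<in> rtrancl_on ?V E" if XY: "X \<in> ?V" "Y \<in> ?V" for X Y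
  proof -
    obtain S T where "arc_system k P S" "X = isotopy_class P ` S"
      "arc_system k P T" "Y = isotopy_class P ` T"
      using XY unfolding arc_tuples_def by auto
    then obtain S' T' where ST: "inner_system P S'" "card S' = k" "X = isotopy_class P ` S'"
      "inner_system P T'" "card T' = k" "Y = isotopy_class P ` T'"
      using inner_representatives[OF assms(3,5)] by metis
    have "(S', T') \<in> (exchange k P)\<^sup>*"
      using exchange_connected[OF assms(3,5) _ _ ST(1,2,4,5)] assms(1,2,4) by simp
    then show ?thesis
      using step[OF ST(1,2)] ST(3,6) by simp
  qed
  moreover have "?V \<noteq> {}"
  proof -
    have "inner_system P {}"
      unfolding inner_system_def by simp
    then obtain S where "inner_system P S" "card S = k"
      using inner_system_extend[OF assms(3,5), of k "{}"] assms(2,4) by auto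
    then show ?thesis
      using vertex by auto
  qed
  ultimately show ?thesis
    unfolding Digraph_Component.connected_def strongly_connected_def reachable_def E_def
    by (simp add: arc_tuple_complex_def)
qed

end
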